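(* Let $\mathbb{D}$ be a quantum divergence that satisfies the direct-sum property and the vanishing-first-derivative property. Let $\mathcal{N}\colon A\to B'$ and $\mathcal{M}\colon A\to B$ be quantum channels, $\sigma_{RA}$ a quantum state, and $\eta\geq 0$. Then the following are equivalent: (i) For all classical-quantum states $\rho_{RUA}$ with marginal $\rho_{RA}=\sigma_{RA}$, where $U$ is a classical system of size $|U|=2$, $$\eta\,\mathbb{I}(U:B|R)\geq\mathbb{I}(U:B'|R).$$ (ii) For all classical-quantum states $\rho_{RUA}$ with marginal $\rho_{RA}=\sigma_{RA}$, where $U$ is an arbitrary classical system, $$\eta\,\mathbb{I}(U:B|R)\geq\mathbb{I}(U:B'|R).$$ (iii) For all quantum states $\rho_{RA}$ with $\operatorname{supp}(\rho_{RA})\subseteq\operatorname{supp}(\sigma_{RA})$, $$\eta\left[\mathbb{D}(\mathcal{M}(\rho_{RA})\|\mathcal{M}(\sigma_{RA}))-\mathbb{D}(\rho_R\|\sigma_R)\right]\geq\mathbb{D}(\mathcal{N}(\rho_{RA})\|\mathcal{N}(\sigma_{RA}))-\mathbb{D}(\rho_R\|\sigma_R).$$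
   Context: All systems are finite-dimensional. A channel on $A$ acts as the identity on other systems. A quantum divergence $\mathbb{D}$ maps pairs of quantum states (on a common system) to real numbers and satisfies data processing $\mathbb{D}(\rho\|\sigma)\geq\mathbb{D}(\mathcal{N}(\rho)\|\mathcal{N}(\sigma))$ for all channels $\mathcal{N}$. Direct-sum property: for every classical-quantum state $\rho_{UA}=\sum_x p(x)|x\rangle\langle x|_U\otimes\rho^x_A$ (for any quantum system $A$), $\mathbb{D}(\rho_{UA}\|\rho_U\otimes\rho_A)=\sum_x p(x)\,\mathbb{D}(\rho^x_A\|\rho_A)$. Vanishing first derivative: for all states $\rho,\sigma$ with $\operatorname{supp}(\rho)\subseteq\operatorname{supp}(\sigma)$, $\left.\frac{\partial}{\partial\lambda}\mathbb{D}(\lambda\rho+(1-\lambda)\sigma\|\sigma)\right|_{\lambda=0^+}=0$. Define $\mathbb{I}(A:B)=\mathbb{D}(\rho_{AB}\|\rho_A\otimes\rho_B)$ and $\mathbb{I}(A:B|C)=\mathbb{I}(A:BC)-\mathbb{I}(A:C)=\mathbb{D}(\rho_{ABC}\|\rho_A\otimes\rho_{BC})-\mathbb{D}(\rho_{AC}\|\rho_A\otimes\rho_C)$. In (i) and (ii), $\mathbb{I}(U:B|R)$ is evaluated on $\mathcal{M}(\rho_{RUA})$ and $\mathbb{I}(U:B'|R)$ on $\mathcal{N}(\rho_{RUA})$, where $\rho_{RUA}=\sum_u p(u)|u\rangle\langle u|_U\otimes\rho^u_{RA}$. *)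

theory Defs
  imports
    "Jordan_Normal_Form.Matrix_Kernel"
    Complex_Main
begin

section \<open>States on finite-dimensional systems\<close>

text \<open>
  A system of dimension \<open>n\<close> is the space of complex vectors of length \<open>n\<close>, and operators on it are
  the matrices in \<open>carrier_mat n n\<close>.
\<close>

definition mat_trace :: "complex mat \<Rightarrow> complex" where
  "mat_trace X = (\<Sum>i<dim_row X. X $$ (i, i))"

text \<open>
  In the order on \<open>complex\<close>, \<open>0 \<le> z\<close> means that \<open>z\<close> is real and nonnegative, so Hermiticity is
  included.
\<close>

definition psd :: "nat \<Rightarrow> complex mat \<Rightarrow> bool" where
  "psd n X \<longleftrightarrow> X \<in> carrier_mat n n \<and> (\<forall>v \<in> carrier_vec n. 0 \<le> (X *\<^sub>v v) \<bullet>c v)"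

text \<open>The trace condition rules out \<open>n = 0\<close>.\<close>

definition state :: "nat \<Rightarrow> complex mat \<Rightarrow> bool" where
  "state n \<rho> \<longleftrightarrow> psd n \<rho> \<and> mat_trace \<rho> = 1"

definition supp :: "complex mat \<Rightarrow> complex vec set" where
  "supp X = {v \<in> carrier_vec (dim_col X). \<forall>w \<in> mat_kernel X. v \<bullet>c w = 0}"


section \<open>Composite systems\<close>

text \<open>
  A composite system of dimension \<open>a * b\<close> uses the product basis in lexicographic order: the basis
  vector with index \<open>i * b + k\<close> is \<open>|i> \<otimes> |k>\<close>.
\<close>

definition kron :: "complex mat \<Rightarrow> complex mat \<Rightarrow> complex mat" where
  "kron X Y = mat (dim_row X * dim_row Y) (dim_col X * dim_col Y)
     (\<lambda>(i, j). X $$ (i div dim_row Y, j div dim_col Y) * Y $$ (i mod dim_row Y, j mod dim_col Y))"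

definition marginal_fst :: "nat \<Rightarrow> nat \<Rightarrow> complex mat \<Rightarrow> complex mat" where
  "marginal_fst a b X = mat a a (\<lambda>(i, j). \<Sum>k<b. X $$ (i * b + k, j * b + k))"

definition marginal_snd :: "nat \<Rightarrow> nat \<Rightarrow> complex mat \<Rightarrow> complex mat" where
  "marginal_snd a b X = mat b b (\<lambda>(k, l). \<Sum>i<a. X $$ (i * b + k, i * b + l))"

definition block :: "nat \<Rightarrow> complex mat \<Rightarrow> nat \<Rightarrow> nat \<Rightarrow> complex mat" where
  "block m X i j = mat m m (\<lambda>(k, l). X $$ (i * m + k, j * m + l))"

text \<open>
  The action of \<open>N\<close> on the second factor of a system of dimension \<open>r * m\<close>, as the identity on the
  first: since \<open>X = (\<Sum>i j. |i><j| \<otimes> block m X i j)\<close>, this is \<open>(\<Sum>i j. |i><j| \<otimes> N (block m X i j))\<close>.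
  See \<open>on_snd_kron\<close> below.
\<close>

definition on_snd :: "nat \<Rightarrow> nat \<Rightarrow> nat \<Rightarrow> (complex mat \<Rightarrow> complex mat) \<Rightarrow> complex mat \<Rightarrow> complex mat"
where
  "on_snd r m n N X = mat (r * n) (r * n)
     (\<lambda>(i, j). N (block m X (i div n) (j div n)) $$ (i mod n, j mod n))"


section \<open>Channels\<close>

definition linear_map :: "nat \<Rightarrow> nat \<Rightarrow> (complex mat \<Rightarrow> complex mat) \<Rightarrow> bool" where
  "linear_map m n N \<longleftrightarrow>
     (\<forall>X \<in> carrier_mat m m. N X \<in> carrier_mat n n) \<and>
     (\<forall>X \<in> carrier_mat m m. \<forall>Y \<in> carrier_mat m m. N (X + Y) = N X + N Y) \<and>
     (\<forall>c. \<forall>X \<in> carrier_mat m m. N (c \<cdot>\<^sub>m X) = c \<cdot>\<^sub>m N X)"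

definition completely_positive :: "nat \<Rightarrow> nat \<Rightarrow> (complex mat \<Rightarrow> complex mat) \<Rightarrow> bool" where
  "completely_positive m n N \<longleftrightarrow> (\<forall>r X. psd (r * m) X \<longrightarrow> psd (r * n) (on_snd r m n N X))"

definition trace_preserving :: "nat \<Rightarrow> (complex mat \<Rightarrow> complex mat) \<Rightarrow> bool" where
  "trace_preserving m N \<longleftrightarrow> (\<forall>X \<in> carrier_mat m m. mat_trace (N X) = mat_trace X)"

definition channel :: "nat \<Rightarrow> nat \<Rightarrow> (complex mat \<Rightarrow> complex mat) \<Rightarrow> bool" where
  "channel m n N \<longleftrightarrow> linear_map m n N \<and> completely_positive m n N \<and> trace_preserving m N"


section \<open>Classical-quantum states\<close>

definition basis_proj :: "nat \<Rightarrow> nat \<Rightarrow> complex mat" where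
  "basis_proj k x = mat k k (\<lambda>(i, j). if i = x \<and> j = x then 1 else 0)"

definition ensemble :: "nat \<Rightarrow> nat \<Rightarrow> (nat \<Rightarrow> real) \<Rightarrow> (nat \<Rightarrow> complex mat) \<Rightarrow> bool" where
  "ensemble k n p \<rho>s \<longleftrightarrow> (\<forall>x<k. 0 \<le> p x) \<and> (\<Sum>x<k. p x) = 1 \<and> (\<forall>x<k. state n (\<rho>s x))"

text \<open>The state \<open>\<Sum>x<k. p x |x><x| \<otimes> \<rho>s x\<close>, with the sum taken entrywise.\<close>

definition cq_mat :: "nat \<Rightarrow> nat \<Rightarrow> (nat \<Rightarrow> real) \<Rightarrow> (nat \<Rightarrow> complex mat) \<Rightarrow> complex mat" where
  "cq_mat k n p \<rho>s = mat (k * n) (k * n)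
     (\<lambda>ij. \<Sum>x<k. complex_of_real (p x) * kron (basis_proj k x) (\<rho>s x) $$ ij)"

definition cq_state :: "nat \<Rightarrow> nat \<Rightarrow> complex mat \<Rightarrow> bool" where
  "cq_state k n \<rho> \<longleftrightarrow> (\<exists>p \<rho>s. ensemble k n p \<rho>s \<and> \<rho> = cq_mat k n p \<rho>s)"


section \<open>Divergences\<close>

type_synonym divergence = "complex mat \<Rightarrow> complex mat \<Rightarrow> real"

text \<open>
  Only the values on pairs of states of equal dimension matter; the dimension is that of the matrices.
\<close>

definition quantum_divergence :: "divergence \<Rightarrow> bool" where
  "quantum_divergence D \<longleftrightarrow>
     (\<forall>m n N \<rho> \<sigma>. channel m n N \<longrightarrow> state m \<rho> \<longrightarrow> state m \<sigma> \<longrightarrow> D \<rho> \<sigma> \<ge> D (N \<rho>) (N \<sigma>))"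

definition direct_sum_property :: "divergence \<Rightarrow> bool" where
  "direct_sum_property D \<longleftrightarrow>
     (\<forall>k n p \<rho>s. ensemble k n p \<rho>s \<longrightarrow>
        (let \<rho> = cq_mat k n p \<rho>s; \<rho>U = marginal_fst k n \<rho>; \<rho>A = marginal_snd k n \<rho>
         in D \<rho> (kron \<rho>U \<rho>A) = (\<Sum>x<k. p x * D (\<rho>s x) \<rho>A)))"

definition vanishing_first_derivative :: "divergence \<Rightarrow> bool" where
  "vanishing_first_derivative D \<longleftrightarrow>
     (\<forall>n \<rho> \<sigma>. state n \<rho> \<longrightarrow> state n \<sigma> \<longrightarrow> supp \<rho> \<subseteq> supp \<sigma> \<longrightarrow>
        ((\<lambda>t. D (complex_of_real t \<cdot>\<^sub>m \<rho> + complex_of_real (1 - t) \<cdot>\<^sub>m \<sigma>) \<sigma>)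
           has_real_derivative 0) (at_right 0))"

definition mutual_info :: "divergence \<Rightarrow> nat \<Rightarrow> nat \<Rightarrow> complex mat \<Rightarrow> real" where
  "mutual_info D a b \<rho> = D \<rho> (kron (marginal_fst a b \<rho>) (marginal_snd a b \<rho>))"

text \<open>
  \<open>I(A:B|C)\<close> for a state whose tensor factors come in the order \<open>A\<close>, \<open>C\<close>, \<open>B\<close> (dimensions
  \<open>a\<close>, \<open>c\<close>, \<open>b\<close>). With the conditioning system in the middle, the bipartition \<open>A : BC\<close> and the
  marginal on \<open>AC\<close> need no reordering of the factors.
\<close>

definition cond_mutual_info :: "divergence \<Rightarrow> nat \<Rightarrow> nat \<Rightarrow> nat \<Rightarrow> complex mat \<Rightarrow> real" where
  "cond_mutual_info D a c b \<rho> =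
     mutual_info D a (c * b) \<rho> - mutual_info D a c (marginal_fst (a * c) b \<rho>)"


section \<open>The encodings agree with the tensor product\<close>

lemma less_mult_add:
  fixes i k a b :: nat
  assumes "i < a" "k < b"
  shows "i * b + k < a * b"
proof -
  have "i * b + k < Suc i * b"
    using assms(2) by simp
  also have "\<dots> \<le> a * b"
    using assms(1) by (intro mult_le_mono1) simp
  finally show ?thesis .
qed

lemma block_kron:
  assumes "X \<in> carrier_mat r r" "Y \<in> carrier_mat m m" "i < r" "j < r"
  shows "block m (kron X Y) i j = X $$ (i, j) \<cdot>\<^sub>m Y"
  using assms by (intro eq_matI) (auto simp: block_def kron_def less_mult_add)

lemma on_snd_kron:
  assumes N: "linear_map m n N" and X: "X \<in> carrier_mat r r" and Y: "Y \<in> carrier_mat m m"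
  shows "on_snd r m n N (kron X Y) = kron X (N Y)"
proof -
  have NY: "N Y \<in> carrier_mat n n"
    using N Y by (auto simp: linear_map_def)
  show ?thesis
  proof (rule eq_matI)
    fix i j assume "i < dim_row (kron X (N Y))" "j < dim_col (kron X (N Y))"
    then have ij: "i < r * n" "j < r * n"
      using X NY by (auto simp: kron_def)
    then have n: "0 < n" and d: "i div n < r" "j div n < r"
      by (auto simp: less_mult_imp_div_less intro: gr0I)
    have "N (block m (kron X Y) (i div n) (j div n)) = X $$ (i div n, j div n) \<cdot>\<^sub>m N Y"
      using N Y block_kron[OF X Y d] by (auto simp: linear_map_def)
    then show "on_snd r m n N (kron X Y) $$ (i, j) = kron X (N Y) $$ (i, j)"
      using ij n X NY by (auto simp: on_snd_def kron_def)
  qed (use X NY in \<open>auto simp: on_snd_def kron_def\<close>)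
qed

lemma marginal_fst_kron:
  assumes "X \<in> carrier_mat a a" "Y \<in> carrier_mat b b"
  shows "marginal_fst a b (kron X Y) = mat_trace Y \<cdot>\<^sub>m X"
  using assms
  by (intro eq_matI)
     (auto simp: marginal_fst_def mat_trace_def kron_def less_mult_add sum_distrib_left
       mult.commute intro!: sum.cong)

lemma marginal_snd_kron:
  assumes "X \<in> carrier_mat a a" "Y \<in> carrier_mat b b"
  shows "marginal_snd a b (kron X Y) = mat_trace X \<cdot>\<^sub>m Y"
  using assms
  by (intro eq_matI)
     (auto simp: marginal_snd_def mat_trace_def kron_def less_mult_add sum_distrib_right intro!: sum.cong)

end

theory Submission
  imports Defs
begin

text \<open>
  By the direct-sum property, \<open>I(U:B|R)\<close> of a classical-quantum state is the average over \<open>U\<close> of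
  the gaps \<open>G(\<rho>\<^sup>u) = D(M \<rho>\<^sup>u || M \<sigma>) - D(\<rho>\<^sup>u\<^sub>R || \<sigma>\<^sub>R)\<close>, so (iii) implies (ii) by averaging. Conversely, if
  \<open>supp \<rho>\<close> lies in \<open>supp \<sigma>\<close> then \<open>(1 + a) \<sigma> = \<rho> + a \<tau>\<close> for some \<open>a > 0\<close> and some state \<open>\<tau>\<close>, and \<open>\<sigma>\<close> is the
  mixture of \<open>\<rho>\<close> and \<open>\<sigma>\<^sub>t = t \<tau> + (1 - t) \<sigma>\<close> with weights proportional to \<open>t\<close> and \<open>a\<close>. Applying (i) to
  this binary ensemble and dividing by the weight of \<open>\<rho>\<close> compares \<open>G(\<rho>) + a G(\<sigma>\<^sub>t) / t\<close> for the two channels;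
  as \<open>t\<close> tends to \<open>0\<close> the second term vanishes by the vanishing first derivative, because \<open>G(\<sigma>) = 0\<close>.
\<close>

section \<open>Positive semidefinite matrices\<close>

text \<open>The form takes coefficient and coordinate functions instead of matrices and vectors, so
  that the induction in \<open>qform_gram\<close> can lower \<open>n\<close> without rebuilding
  either.\<close>

definition qform :: "nat \<Rightarrow> (nat \<Rightarrow> nat \<Rightarrow> complex) \<Rightarrow> (nat \<Rightarrow> complex) \<Rightarrow> complex" where
  "qform n F v = (\<Sum>i<n. \<Sum>j<n. F i j * v j * cnj (v i))"

section \<open>Hermiticity and Gram representations of nonnegative forms\<close>

lemma qform_single:
  assumes "i < n"
  shows "qform n F (\<lambda>k. if k = i then 1 else 0) = F i i"
proof -
  have "qform n F (\<lambda>k. if k = i then 1 else 0) = (\<Sum>k<n. if k = i then F i i else 0)"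
    unfolding qform_def using assms
    by (intro sum.cong refl) (simp add: if_distrib[of "(*) _"] cong: if_cong)
  then show ?thesis
    using assms by simp
qed

lemma qform_pair:
  assumes "i < n" "j < n" "i \<noteq> j"
  shows "qform n F (\<lambda>k. if k = i then x else if k = j then y else 0) =
    F i i * x * cnj x + F i j * y * cnj x + F j i * x * cnj y + F j j * y * cnj y"
proof -
  let ?v = "\<lambda>k. if k = i then x else if k = j then y else 0"
  have inner: "(\<Sum>l<n. F k l * ?v l * c) = (\<Sum>l\<in>{i, j}. F k l * ?v l * c)" for k c
    using assms by (intro sum.mono_neutral_right) auto
  have "qform n F ?v = (\<Sum>k\<in>{i, j}. \<Sum>l<n. F k l * ?v l * cnj (?v k))"
    unfolding qform_def using assms by (intro sum.mono_neutral_right) auto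
  also have "\<dots> = (\<Sum>k\<in>{i, j}. \<Sum>l\<in>{i, j}. F k l * ?v l * cnj (?v k))"
    by (simp only: inner)
  finally show ?thesis
    using assms by simp
qed

text \<open>The form is real at \<open>e_i + e_j\<close> and at \<open>e_i + \<i> e_j\<close>; the
  first fixes the imaginary part of \<open>F j i\<close>, the second its real part.\<close>

lemma qform_hermitian:
  assumes pos: "\<And>v. 0 \<le> qform n F v" and "i < n" "j < n"
  shows "F j i = cnj (F i j)"
proof (cases "i = j")
  case True
  have "0 \<le> F i i"
    using pos[of "\<lambda>k. if k = i then 1 else 0"] qform_single[OF \<open>i < n\<close>] by simp
  then show ?thesis
    using True by (simp add: less_eq_complex_def complex_eq_iff)
next
  case False
  have "0 \<le> F i i" "0 \<le> F j j"
    using pos[of "\<lambda>k. if k = i then 1 else 0"] pos[of "\<lambda>k. if k = j then 1 else 0"] assms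
    by (simp_all add: qform_single)
  then show ?thesis
    using pos[of "\<lambda>k. if k = i then 1 else if k = j then 1 else 0"]
      pos[of "\<lambda>k. if k = i then 1 else if k = j then \<i> else 0"]
    unfolding qform_pair[OF assms(2,3) False]
    by (simp add: less_eq_complex_def complex_eq_iff)
qed

text \<open>Along \<open>e_i - s F_ji e_j\<close> the term quadratic in \<open>s\<close> carries the
  factor \<open>F j j = 0\<close>, so the form is affine in \<open>s\<close>. It stays nonnegative
  for every real \<open>s\<close> only if \<open>F i j = 0\<close>.\<close>

lemma qform_diag_zero:
  assumes pos: "\<And>v. 0 \<le> qform n F v" and "i < n" "j < n" and zero: "F j j = 0"
  shows "F i j = 0"
proof (cases "i = j")
  case False
  have herm: "F j i = cnj (F i j)"
    using qform_hermitian[OF pos] assms by blast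
  have bound: "2 * s * (cmod (F i j))\<^sup>2 \<le> Re (F i i)" for s :: real
    using pos[of "\<lambda>k. if k = i then 1 else if k = j then - (of_real s * F j i) else 0"]
    unfolding qform_pair[OF assms(2,3) False] herm cmod_power2
    by (simp add: less_eq_complex_def zero power2_eq_square algebra_simps)
  show ?thesis
  proof (rule ccontr)
    assume "F i j \<noteq> 0"
    \<comment> \<open>This \<open>s\<close> makes the left side of \<open>bound\<close> equal to
      \<open>Re (F i i) + 1\<close>.\<close>
    then show False
      using bound[of "(Re (F i i) + 1) / (2 * (cmod (F i j))\<^sup>2)"] by (simp add: field_simps)
  qed
qed (use zero in simp)

text \<open>Cholesky factorisation by induction on \<open>n\<close>: one vector built from the last
  column accounts for the last row and column, and what remains is a nonnegative form in one
  variable fewer. Kronecker products, marginals and kernels are all treated through this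
  representation.\<close>

lemma qform_gram:
  assumes "\<And>v. 0 \<le> qform n F v"
  shows "\<exists>w. \<forall>i<n. \<forall>j<n. F i j = (\<Sum>a<n. w a i * cnj (w a j))"
  using assms
proof (induction n arbitrary: F)
  case (Suc n)
  define d where "d = F n n"
  have herm: "F j i = cnj (F i j)" if "i \<le> n" "j \<le> n" for i j
    using qform_hermitian[OF Suc.prems, of i j] that by simp
  have d0: "0 \<le> d"
    using Suc.prems[of "\<lambda>k. if k = n then 1 else 0"] by (simp add: qform_single d_def)
  then have d_real: "cnj d = d"
    by (simp add: less_eq_complex_def complex_eq_iff)
  have col0: "F i n = 0" if "d = 0" "i \<le> n" for i
    using qform_diag_zero[OF Suc.prems, of i n] that by (simp add: d_def)
  \<comment> \<open>The Schur complement of the last diagonal entry \<open>d\<close>. If \<open>d = 0\<close>, the last row and column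
    vanish, and division by zero makes \<open>F'\<close> the plain restriction of \<open>F\<close>, so no case split is
    needed.\<close>
  define F' where "F' i j = F i j - F i n * F n j / d" for i j
  have "0 \<le> qform n F' v" for v
  proof -
    define S where "S = (\<Sum>j<n. F n j * v j)"
    \<comment> \<open>Completing the square: this last coordinate minimises the form. For
      \<open>d = 0\<close>, division by zero gives \<open>z = 0\<close>.\<close>
    define z where "z = - S / d"
    let ?v = "v(n := z)"
    have cS: "(\<Sum>i<n. F i n * cnj (v i)) = cnj S"
      unfolding S_def cnj_sum by (intro sum.cong refl) (use herm[of n] in simp)
    have "qform (Suc n) F ?v
        = qform n F v + z * (\<Sum>i<n. F i n * cnj (v i)) + S * cnj z + d * z * cnj z"
      by (simp add: qform_def S_def d_def sum.distrib sum_distrib_left sum_distrib_right mult_ac)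
    also have "\<dots> = qform n F v - S * cnj S / d"
      unfolding cS z_def using d_real by (cases "d = 0") (simp_all add: field_simps)
    also have "\<dots> = qform n F v - (\<Sum>i<n. F i n * cnj (v i)) * S / d"
      by (simp add: cS)
    also have "\<dots> = qform n F' v"
      by (simp add: qform_def F'_def S_def sum_distrib_left sum_distrib_right sum_subtractf
          sum_divide_distrib algebra_simps)
    finally show ?thesis
      using Suc.prems by metis
  qed
  then obtain w where w: "\<And>i j. i < n \<Longrightarrow> j < n \<Longrightarrow> F' i j = (\<Sum>a<n. w a i * cnj (w a j))"
    using Suc.IH[of F'] by blast
  define s where "s = complex_of_real (sqrt (Re d))"
  have s: "s * cnj s = d"
    using d0 by (simp add: s_def less_eq_complex_def complex_eq_iff)
  \<comment> \<open>The new vector is the last column divided by the square root of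
    \<open>d\<close>; it is zero if \<open>d = 0\<close>. The old vectors are extended by
    \<open>0\<close> at index \<open>n\<close>.\<close>
  define w' where "w' a i = (if a = n then F i n / s else if i = n then 0 else w a i)" for a i
  have last: "w' n i * cnj (w' n j) = F i n * F n j / d" if "i \<le> n" "j \<le> n" for i j
    using herm[OF _ that(2), of n] s by (simp add: w'_def)
  have "F i j = (\<Sum>a<Suc n. w' a i * cnj (w' a j))" if "i < Suc n" "j < Suc n" for i j
  proof (cases "i = n \<or> j = n")
    case True
    then have "(\<Sum>a<n. w' a i * cnj (w' a j)) = 0"
      by (intro sum.neutral) (auto simp: w'_def)
    moreover have "F i j = F i n * F n j / d"
      using True col0[of i] col0[of j] herm[of n j] that by (cases "d = 0") (auto simp: d_def)
    ultimately show ?thesis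
      using last that by simp
  next
    case False
    then have "(\<Sum>a<n. w' a i * cnj (w' a j)) = F' i j"
      using that by (subst w) (auto simp: w'_def intro!: sum.cong)
    then show ?thesis
      using last that by (simp add: F'_def)
  qed
  then show ?case
    by blast
qed simp

text \<open>After exchanging the sums, each \<open>a\<close> contributes a product
  \<open>z * cnj z\<close>. The index set \<open>S\<close> is arbitrary so that the product sets in
  \<open>kron_psd\<close> and \<open>marginal_fst_psd\<close> fit.\<close>

lemma gram_qform:
  assumes "\<And>i j. i < n \<Longrightarrow> j < n \<Longrightarrow> F i j = (\<Sum>a\<in>S. w a i * cnj (w a j))"
  shows "qform n F v = of_real (\<Sum>a\<in>S. (cmod (\<Sum>i<n. cnj (w a i) * v i))\<^sup>2)"
proof -
  have "qform n F v = (\<Sum>i<n. \<Sum>j<n. \<Sum>a\<in>S. w a i * cnj (w a j) * v j * cnj (v i))"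
    unfolding qform_def by (intro sum.cong refl) (simp add: assms sum_distrib_right)
  also have "\<dots> = (\<Sum>i<n. \<Sum>a\<in>S. \<Sum>j<n. w a i * cnj (w a j) * v j * cnj (v i))"
    by (intro sum.cong refl sum.swap)
  also have "\<dots> = (\<Sum>a\<in>S. \<Sum>i<n. \<Sum>j<n. w a i * cnj (w a j) * v j * cnj (v i))"
    by (rule sum.swap)
  also have "\<dots> = (\<Sum>a\<in>S. (\<Sum>i<n. cnj (w a i) * v i) * cnj (\<Sum>i<n. cnj (w a i) * v i))"
    unfolding cnj_sum sum_product
    by (subst sum.swap) (intro sum.cong refl, simp add: mult_ac)
  finally show ?thesis
    by (simp only: of_real_sum complex_norm_square)
qed

text \<open>Induction on \<open>m\<close>. If some \<open>u\<close> is annihilated by the earlier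
  functionals but not by \<open>f m\<close>, subtract from \<open>g\<close> the multiple of
  \<open>f m\<close> that agrees with \<open>g\<close> at \<open>u\<close>; correcting
  \<open>v\<close> by a multiple of \<open>u\<close> shows that the induction hypothesis applies to
  the difference. Otherwise \<open>f m\<close> vanishes wherever the earlier ones do and receives
  coefficient \<open>0\<close>.\<close>

lemma functional_in_span:
  fixes f :: "nat \<Rightarrow> (nat \<Rightarrow> complex)" and g :: "nat \<Rightarrow> complex"
  assumes "\<And>v. (\<And>a. a < m \<Longrightarrow> (\<Sum>i<n. f a i * v i) = 0) \<Longrightarrow> (\<Sum>i<n. g i * v i) = 0"
  shows "\<exists>c. \<forall>v. (\<Sum>i<n. g i * v i) = (\<Sum>a<m. c a * (\<Sum>i<n. f a i * v i))"
  using assms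
proof (induction m arbitrary: g)
  case (Suc m)
  define app where "app h v = (\<Sum>i<n. h i * v i)" for h v :: "nat \<Rightarrow> complex"
  note Suc' = Suc[folded app_def]
  have lin: "app h (\<lambda>i. x i - c * y i) = app h x - c * app h y" for h x y c
    by (simp add: app_def right_diff_distrib sum_subtractf sum_distrib_left mult_ac)
  have lin': "app (\<lambda>i. h i - c * k i) v = app h v - c * app k v" for h k v c
    by (simp add: app_def left_diff_distrib sum_subtractf sum_distrib_left mult.assoc)
  show ?case
  proof (cases "\<exists>u. (\<forall>a<m. app (f a) u = 0) \<and> app (f m) u \<noteq> 0")
    case True
    then obtain u where u: "\<forall>a<m. app (f a) u = 0" "app (f m) u \<noteq> 0"
      by blast
    define q where "q = app g u / app (f m) u"
    have "app (\<lambda>i. g i - q * f m i) v = 0" if v: "\<And>a. a < m \<Longrightarrow> app (f a) v = 0" for v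
    proof -
      define r where "r = app (f m) v / app (f m) u"
      have "app (f m) v = r * app (f m) u"
        using u by (simp add: r_def)
      then have "app g (\<lambda>i. v i - r * u i) = 0"
        using u v by (intro Suc'(2)) (auto simp: lin less_Suc_eq)
      then have "app g v = r * app g u"
        by (simp only: lin) simp
      then show ?thesis
        by (simp only: lin') (simp add: q_def r_def)
    qed
    then obtain c where c: "\<And>v. app g v - q * app (f m) v = (\<Sum>a<m. c a * app (f a) v)"
      using Suc'(1)[of "\<lambda>i. g i - q * f m i"] unfolding lin' by blast
    have "app g v = (\<Sum>a<Suc m. (c(m := q)) a * app (f a) v)" for v
      using c[of v] by (simp add: algebra_simps)
    then show ?thesis
      unfolding app_def by blast
  next
    case False
    then obtain c where c: "\<And>v. app g v = (\<Sum>a<m. c a * app (f a) v)"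
      using Suc' less_Suc_eq by metis
    have "app g v = (\<Sum>a<Suc m. (c(m := 0)) a * app (f a) v)" for v
      using c[of v] by simp
    then show ?thesis
      unfolding app_def by blast
  qed
qed simp

section \<open>Positive semidefinite matrices as nonnegative forms\<close>

lemma inner_eq_qform:
  assumes "X \<in> carrier_mat n n" "v \<in> carrier_vec n"
  shows "(X *\<^sub>v v) \<bullet>c v = qform n (\<lambda>i j. X $$ (i, j)) (\<lambda>i. v $ i)"
  using assms
  by (simp add: qform_def scalar_prod_def sum_distrib_right atLeast0LessThan)

lemma qform_cong:
  assumes "\<And>i. i < n \<Longrightarrow> u i = v i"
  shows "qform n F u = qform n F v"
  using assms by (simp add: qform_def)

lemma psd_iff_qform:
  "psd n X \<longleftrightarrow> X \<in> carrier_mat n n \<and> (\<forall>v. 0 \<le> qform n (\<lambda>i j. X $$ (i, j)) v)"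
proof -
  have "0 \<le> qform n (\<lambda>i j. X $$ (i, j)) v" if "psd n X" for v
  proof -
    have "(X *\<^sub>v vec n v) \<bullet>c vec n v = qform n (\<lambda>i j. X $$ (i, j)) v"
      using that by (subst inner_eq_qform) (auto simp: psd_def intro: qform_cong)
    then show ?thesis
      using that by (metis psd_def vec_carrier)
  qed
  then show ?thesis
    by (auto simp: psd_def inner_eq_qform)
qed

lemma psd_carrier: "psd n X \<Longrightarrow> X \<in> carrier_mat n n"
  by (simp add: psd_def)

lemma psd_gram:
  assumes "psd n X"
  obtains w where "\<forall>i<n. \<forall>j<n. X $$ (i, j) = (\<Sum>a<n. w a i * cnj (w a j))"
  using assms qform_gram[of n "\<lambda>i j. X $$ (i, j)"] unfolding psd_iff_qform by metis

lemma gram_psd: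
  assumes "X \<in> carrier_mat n n"
    and "\<And>i j. i < n \<Longrightarrow> j < n \<Longrightarrow> X $$ (i, j) = (\<Sum>a\<in>S. w a i * cnj (w a j))"
  shows "psd n X"
  unfolding psd_iff_qform
  using assms gram_qform[of n "\<lambda>i j. X $$ (i, j)" w S]
  by (simp add: less_eq_complex_def sum_nonneg)

lemma psd_hermitian:
  assumes "psd n X" "i < n" "j < n"
  shows "X $$ (j, i) = cnj (X $$ (i, j))"
  using assms qform_hermitian[of n "\<lambda>i j. X $$ (i, j)" i j] by (simp add: psd_iff_qform)

lemma qform_add:
  assumes "X \<in> carrier_mat n n" "Y \<in> carrier_mat n n"
  shows "qform n (\<lambda>i j. (X + Y) $$ (i, j)) v
    = qform n (\<lambda>i j. X $$ (i, j)) v + qform n (\<lambda>i j. Y $$ (i, j)) v"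
  using assms by (simp add: qform_def distrib_right sum.distrib)

lemma qform_smult:
  assumes "X \<in> carrier_mat n n"
  shows "qform n (\<lambda>i j. (c \<cdot>\<^sub>m X) $$ (i, j)) v = c * qform n (\<lambda>i j. X $$ (i, j)) v"
  using assms by (simp add: qform_def sum_distrib_left mult.assoc)

lemma qform_minus:
  assumes "X \<in> carrier_mat n n" "Y \<in> carrier_mat n n"
  shows "qform n (\<lambda>i j. (X - Y) $$ (i, j)) v
    = qform n (\<lambda>i j. X $$ (i, j)) v - qform n (\<lambda>i j. Y $$ (i, j)) v"
  using assms by (simp add: qform_def left_diff_distrib sum_subtractf)

lemma psd_add: "psd n X \<Longrightarrow> psd n Y \<Longrightarrow> psd n (X + Y)"
  by (simp add: psd_iff_qform qform_add)

lemma psd_smult: "psd n X \<Longrightarrow> 0 \<le> c \<Longrightarrow> psd n (complex_of_real c \<cdot>\<^sub>m X)"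
  by (simp add: psd_iff_qform qform_smult less_eq_complex_def)

section \<open>Product indices, Kronecker products and marginals\<close>

lemma sum_lessThan_mult:
  fixes f :: "nat \<Rightarrow> 'a::comm_monoid_add"
  shows "(\<Sum>i<a * b. f i) = (\<Sum>i<a. \<Sum>k<b. f (i * b + k))"
proof -
  have "sum f {i * b..<i * b + b} = (\<Sum>k<b. f (i * b + k))" for i
    using sum.shift_bounds_nat_ivl[of f 0 "i * b" b] by (simp add: atLeast0LessThan add.commute)
  then show ?thesis
    by (simp flip: sum.nat_group)
qed

lemma div_mod_less:
  fixes i m n :: nat
  assumes "i < m * n"
  shows "i div n < m" "i mod n < n"
  using assms by (auto simp: less_mult_imp_div_less intro!: mod_less_divisor gr0I)

lemma kron_carrier:
  "X \<in> carrier_mat m m \<Longrightarrow> Y \<in> carrier_mat n n \<Longrightarrow> kron X Y \<in> carrier_mat (m * n) (m * n)"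
  by (auto simp: kron_def)

text \<open>The tensor products of the Gram vectors of the two factors are Gram vectors of the
  product.\<close>

lemma kron_psd:
  assumes "psd m X" "psd n Y"
  shows "psd (m * n) (kron X Y)"
proof -
  obtain w where w: "\<forall>i<m. \<forall>j<m. X $$ (i, j) = (\<Sum>a<m. w a i * cnj (w a j))"
    by (rule psd_gram[OF assms(1)])
  obtain u where u: "\<forall>i<n. \<forall>j<n. Y $$ (i, j) = (\<Sum>a<n. u a i * cnj (u a j))"
    by (rule psd_gram[OF assms(2)])
  note XY = psd_carrier[OF assms(1)] psd_carrier[OF assms(2)]
  let ?w = "\<lambda>c i. w (fst c) (i div n) * u (snd c) (i mod n)"
  show ?thesis
  proof (rule gram_psd[where S = "{..<m} \<times> {..<n}" and w = ?w])
    fix i j assume ij: "i < m * n" "j < m * n"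
    have "kron X Y $$ (i, j) = X $$ (i div n, j div n) * Y $$ (i mod n, j mod n)"
      using XY ij by (simp add: kron_def)
    also have "\<dots> = (\<Sum>a<m. \<Sum>b<n. ?w (a, b) i * cnj (?w (a, b) j))"
      using div_mod_less[OF ij(1)] div_mod_less[OF ij(2)] w u
      by (simp add: sum_product mult.assoc mult.left_commute del: mod_less_divisor)
    finally show "kron X Y $$ (i, j) = (\<Sum>c\<in>{..<m} \<times> {..<n}. ?w c i * cnj (?w c j))"
      by (simp add: sum.cartesian_product case_prod_beta)
  qed (use XY kron_carrier in blast)
qed

text \<open>Fixing the second index \<open>k\<close> in a Gram vector \<open>w c\<close> gives a
  vector on the first factor; these vectors, over all \<open>k\<close> and \<open>c\<close>,
  represent the marginal.\<close>

lemma marginal_fst_psd: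
  assumes "psd (a * b) X"
  shows "psd a (marginal_fst a b X)"
proof -
  obtain w where w: "\<forall>i<a * b. \<forall>j<a * b. X $$ (i, j) = (\<Sum>c<a*b. w c i * cnj (w c j))"
    by (rule psd_gram[OF assms])
  let ?w = "\<lambda>c i. w (snd c) (i * b + fst c)"
  show ?thesis
  proof (rule gram_psd[where S = "{..<b} \<times> {..<a * b}" and w = ?w])
    fix i j assume ij: "i < a" "j < a"
    then have "marginal_fst a b X $$ (i, j) = (\<Sum>k<b. \<Sum>c<a*b. ?w (k, c) i * cnj (?w (k, c) j))"
      by (simp add: marginal_fst_def w less_mult_add)
    then show "marginal_fst a b X $$ (i, j) = (\<Sum>c\<in>{..<b} \<times> {..<a * b}. ?w c i * cnj (?w c j))"
      by (simp add: sum.cartesian_product case_prod_beta)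
  qed (simp add: marginal_fst_def)
qed

lemma mat_trace_marginal_fst:
  assumes "X \<in> carrier_mat (a * b) (a * b)"
  shows "mat_trace (marginal_fst a b X) = mat_trace X"
  using assms by (simp add: mat_trace_def marginal_fst_def sum_lessThan_mult)

section \<open>Supports\<close>

lemma mem_kernel_iff:
  assumes "psd n X" "v \<in> carrier_vec n"
    and w: "\<forall>i<n. \<forall>j<n. X $$ (i, j) = (\<Sum>a<n. w a i * cnj (w a j))"
  shows "v \<in> mat_kernel X \<longleftrightarrow> (\<forall>a<n. (\<Sum>i<n. cnj (w a i) * v $ i) = 0)"
    and "(X *\<^sub>v v) \<bullet>c v = 0 \<longleftrightarrow> (\<forall>a<n. (\<Sum>i<n. cnj (w a i) * v $ i) = 0)"
proof -
  note X = psd_carrier[OF assms(1)]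
  show 2: "(X *\<^sub>v v) \<bullet>c v = 0 \<longleftrightarrow> (\<forall>a<n. (\<Sum>i<n. cnj (w a i) * v $ i) = 0)"
    unfolding inner_eq_qform[OF X assms(2)]
    by (subst gram_qform[where S = "{..<n}" and w = w]) (auto simp: w sum_nonneg_eq_0_iff simp del: of_real_sum)
  show "v \<in> mat_kernel X \<longleftrightarrow> (\<forall>a<n. (\<Sum>i<n. cnj (w a i) * v $ i) = 0)"
  proof
    assume "v \<in> mat_kernel X"
    then have "(X *\<^sub>v v) \<bullet>c v = 0"
      using mat_kernelD[OF X] assms(2) by simp
    then show "\<forall>a<n. (\<Sum>i<n. cnj (w a i) * v $ i) = 0"
      using 2 by simp
  next
    assume zero: "\<forall>a<n. (\<Sum>i<n. cnj (w a i) * v $ i) = 0"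
    have "(X *\<^sub>v v) $ i = 0" if "i < n" for i
    proof -
      have "(X *\<^sub>v v) $ i = (\<Sum>j<n. \<Sum>a<n. w a i * (cnj (w a j) * v $ j))"
        using that X assms(2)
        by (simp add: scalar_prod_def atLeast0LessThan w sum_distrib_right mult.assoc)
      also have "\<dots> = (\<Sum>a<n. w a i * (\<Sum>j<n. cnj (w a j) * v $ j))"
        by (subst sum.swap) (simp add: sum_distrib_left)
      finally show ?thesis
        using zero by simp
    qed
    then show "v \<in> mat_kernel X"
      using X assms(2) by (intro mat_kernelI[OF X]) auto
  qed
qed

text \<open>On the kernel of \<open>Y\<close> the form of \<open>c Y - X\<close> is minus that of
  \<open>X\<close>, which forces the latter to vanish. Inclusion of kernels reverses to inclusion of
  supports.\<close>

lemma supp_subsetI: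
  assumes X: "psd n X" and Y: "psd n Y" and dom: "psd n (complex_of_real c \<cdot>\<^sub>m Y - X)"
  shows "supp X \<subseteq> supp Y"
proof -
  have "v \<in> mat_kernel X" if "v \<in> mat_kernel Y" for v
  proof -
    have v: "v \<in> carrier_vec n" "Y *\<^sub>v v = 0\<^sub>v n"
      using mat_kernelD[OF psd_carrier[OF Y] that] .
    let ?q = "\<lambda>X. qform n (\<lambda>i j. X $$ (i, j)) (\<lambda>i. v $ i)"
    have "?q Y = 0"
      using v inner_eq_qform[OF psd_carrier[OF Y] v(1)] by simp
    moreover have "0 \<le> of_real c * ?q Y - ?q X"
      using dom psd_carrier[OF X] psd_carrier[OF Y]
      by (simp add: psd_iff_qform qform_minus qform_smult)
    moreover have "0 \<le> ?q X"
      using X by (simp add: psd_iff_qform)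
    ultimately have "?q X = 0"
      by simp
    then have "(X *\<^sub>v v) \<bullet>c v = 0"
      using inner_eq_qform[OF psd_carrier[OF X] v(1)] by simp
    moreover obtain w where w: "\<forall>i<n. \<forall>j<n. X $$ (i, j) = (\<Sum>a<n. w a i * cnj (w a j))"
      using psd_gram[OF X] .
    ultimately show ?thesis
      by (simp add: mem_kernel_iff[OF X v(1) w])
  qed
  then show ?thesis
    using psd_carrier[OF X] psd_carrier[OF Y] by (auto simp: supp_def)
qed

text \<open>Since \<open>X\<close> is Hermitian, it moves to the other side of the inner product,
  where it annihilates the kernel vector.\<close>

lemma mult_vec_in_supp:
  assumes "psd n X" "v \<in> carrier_vec n"
  shows "X *\<^sub>v v \<in> supp X"
proof -
  note X = psd_carrier[OF assms(1)]
  have "(X *\<^sub>v v) \<bullet>c u = 0" if u: "u \<in> mat_kernel X" for u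
  proof -
    have u': "u \<in> carrier_vec n" "X *\<^sub>v u = 0\<^sub>v n"
      using mat_kernelD[OF X u] .
    have herm: "X $$ (i, j) * v $ j * cnj (u $ i) = v $ j * cnj (X $$ (j, i) * u $ i)"
      if "i < n" "j < n" for i j
      using psd_hermitian[OF assms(1) that(2,1)] by simp
    have "(X *\<^sub>v v) \<bullet>c u = (\<Sum>i<n. \<Sum>j<n. X $$ (i, j) * v $ j * cnj (u $ i))"
      using X u'(1) assms(2) by (simp add: scalar_prod_def sum_distrib_right atLeast0LessThan)
    also have "\<dots> = (\<Sum>j<n. \<Sum>i<n. v $ j * cnj (X $$ (j, i) * u $ i))"
      by (subst sum.swap) (intro sum.cong refl, simp only: herm lessThan_iff)
    also have "\<dots> = (\<Sum>j<n. v $ j * cnj ((X *\<^sub>v u) $ j))"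
      using X u'(1) by (simp add: scalar_prod_def sum_distrib_left atLeast0LessThan)
    finally show ?thesis
      by (simp add: u')
  qed
  then show ?thesis
    using X assms(2) by (auto simp: supp_def)
qed

text \<open>Converse of \<open>supp_subsetI\<close>: the Gram functionals of \<open>X\<close> are
  combinations of those of \<open>Y\<close>, and the size of the coefficients bounds one form by the
  other.\<close>

lemma supp_subset_dominated:
  assumes X: "psd n X" and Y: "psd n Y" and sub: "supp X \<subseteq> supp Y"
  obtains c where "0 < c" "psd n (complex_of_real c \<cdot>\<^sub>m Y - X)"
proof -
  obtain x where x: "\<forall>i<n. \<forall>j<n. X $$ (i, j) = (\<Sum>a<n. x a i * cnj (x a j))"
    by (rule psd_gram[OF X])
  obtain y where y: "\<forall>i<n. \<forall>j<n. Y $$ (i, j) = (\<Sum>a<n. y a i * cnj (y a j))"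
    by (rule psd_gram[OF Y])
  define app where "app h v = (\<Sum>i<n. cnj (h i) * v i)" for h v :: "nat \<Rightarrow> complex"
  \<comment> \<open>If \<open>Y\<close> annihilates \<open>v\<close>, then \<open>X v\<close>, which
    lies in the support of \<open>Y\<close>, is orthogonal to \<open>v\<close>; so the form of
    \<open>X\<close> vanishes at \<open>v\<close>.\<close>
  have "app (x b) v = 0" if b: "b < n" and v: "\<And>a. a < n \<Longrightarrow> app (y a) v = 0" for b v
  proof -
    have "vec n v \<in> mat_kernel Y"
      using v by (subst mem_kernel_iff[OF Y _ y]) (auto simp: app_def)
    moreover have "X *\<^sub>v vec n v \<in> supp Y"
      using mult_vec_in_supp[OF X] sub by auto
    ultimately have "(X *\<^sub>v vec n v) \<bullet>c vec n v = 0"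
      by (auto simp: supp_def)
    then show ?thesis
      using b by (subst (asm) mem_kernel_iff[OF X _ x]) (auto simp: app_def)
  qed
  then have "\<exists>c. \<forall>v. app (x b) v = (\<Sum>a<n. c a * app (y a) v)" if "b < n" for b
    using functional_in_span[of n "\<lambda>a i. cnj (y a i)" n "\<lambda>i. cnj (x b i)"] that
    unfolding app_def by blast
  then obtain c where c: "\<And>b v. b < n \<Longrightarrow> app (x b) v = (\<Sum>a<n. c b a * app (y a) v)"
    by metis
  define Q where "Q v = (\<Sum>a<n. (cmod (app (y a) v))\<^sup>2)" for v
  \<comment> \<open>Triangle inequality, with each functional of \<open>Y\<close> bounded by the
    square root of the whole form \<open>Q v\<close>.\<close>
  have bound: "(cmod (app (x b) v))\<^sup>2 \<le> (\<Sum>a<n. cmod (c b a))\<^sup>2 * Q v" if "b < n" for b v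
  proof -
    have "cmod (app (y a) v) \<le> sqrt (Q v)" if "a < n" for a
      unfolding Q_def using that by (intro real_le_rsqrt member_le_sum) auto
    then have "cmod (\<Sum>a<n. c b a * app (y a) v) \<le> (\<Sum>a<n. cmod (c b a) * sqrt (Q v))"
      by (intro sum_norm_le) (simp add: norm_mult mult_left_mono)
    then have "cmod (app (x b) v) \<le> (\<Sum>a<n. cmod (c b a)) * sqrt (Q v)"
      using that by (simp add: c sum_distrib_right)
    then have "(cmod (app (x b) v))\<^sup>2 \<le> ((\<Sum>a<n. cmod (c b a)) * sqrt (Q v))\<^sup>2"
      by (intro power_mono) auto
    then show ?thesis
      by (simp add: power_mult_distrib Q_def sum_nonneg)
  qed
  \<comment> \<open>The summand \<open>1\<close> keeps \<open>C\<close> positive even if all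
    coefficients vanish.\<close>
  define C where "C = 1 + (\<Sum>b<n. (\<Sum>a<n. cmod (c b a))\<^sup>2)"
  have "0 < C"
    unfolding C_def by (intro add_pos_nonneg sum_nonneg) auto
  moreover have "psd n (complex_of_real C \<cdot>\<^sub>m Y - X)"
  proof -
    have "(\<Sum>b<n. (cmod (app (x b) v))\<^sup>2) \<le> C * Q v" for v
    proof -
      have "(\<Sum>b<n. (cmod (app (x b) v))\<^sup>2) \<le> (\<Sum>b<n. (\<Sum>a<n. cmod (c b a))\<^sup>2 * Q v)"
        using bound by (intro sum_mono) auto
      also have "\<dots> \<le> C * Q v"
        by (simp add: C_def Q_def sum_nonneg distrib_right flip: sum_distrib_right)
      finally show ?thesis .
    qed
    moreover have "qform n (\<lambda>i j. X $$ (i, j)) v = of_real (\<Sum>b<n. (cmod (app (x b) v))\<^sup>2)" for v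
      unfolding app_def by (rule gram_qform) (simp add: x)
    moreover have "qform n (\<lambda>i j. Y $$ (i, j)) v = of_real (Q v)" for v
      unfolding app_def Q_def by (rule gram_qform) (simp add: y)
    ultimately show ?thesis
      using psd_carrier[OF X] psd_carrier[OF Y]
      by (simp add: psd_iff_qform qform_minus qform_smult minus_carrier_mat less_eq_complex_def del: of_real_sum)
  qed
  ultimately show ?thesis
    by (rule that)
qed

section \<open>Linear maps and channels\<close>

lemma linear_mapD:
  assumes "linear_map m n N"
  shows "X \<in> carrier_mat m m \<Longrightarrow> N X \<in> carrier_mat n n"
    and "X \<in> carrier_mat m m \<Longrightarrow> Y \<in> carrier_mat m m \<Longrightarrow> N (X + Y) = N X + N Y"
    and "X \<in> carrier_mat m m \<Longrightarrow> N (c \<cdot>\<^sub>m X) = c \<cdot>\<^sub>m N X"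
  using assms by (auto simp: linear_map_def)

lemma linear_map_minus:
  assumes N: "linear_map m n N" and X: "X \<in> carrier_mat m m" and Y: "Y \<in> carrier_mat m m"
  shows "N (X - Y) = N X - N Y"
proof -
  have diff: "A - B = A + (-1) \<cdot>\<^sub>m B" if "A \<in> carrier_mat k k" "B \<in> carrier_mat k k"
    for A B :: "complex mat" and k
    using that by (intro eq_matI) auto
  show ?thesis
    using X Y linear_mapD[OF N] by (subst (1 2) diff) auto
qed

lemma linear_map_zero:
  assumes N: "linear_map m n N"
  shows "N (0\<^sub>m m m) = 0\<^sub>m n n"
proof -
  have "N (0 \<cdot>\<^sub>m 0\<^sub>m m m) = 0 \<cdot>\<^sub>m N (0\<^sub>m m m)"
    by (rule linear_mapD(3)[OF N]) simp
  moreover have "0 \<cdot>\<^sub>m 0\<^sub>m m m = (0\<^sub>m m m :: complex mat)"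
    by (intro eq_matI) auto
  moreover have "0 \<cdot>\<^sub>m N (0\<^sub>m m m) = 0\<^sub>m n n"
    using linear_mapD(1)[OF N, of "0\<^sub>m m m"] by (intro eq_matI) auto
  ultimately show ?thesis
    by simp
qed

lemma linear_map_sum:
  fixes k :: nat
  assumes N: "linear_map m n N" and B: "\<And>x. x < k \<Longrightarrow> B x \<in> carrier_mat m m"
  shows "N (mat m m (\<lambda>ij. \<Sum>x<k. c x * B x $$ ij)) = mat n n (\<lambda>ij. \<Sum>x<k. c x * N (B x) $$ ij)"
  using B
proof (induction k)
  case 0
  show ?case
    using linear_map_zero[OF N] by (simp add: zero_mat_def)
next
  case (Suc k)
  let ?S = "mat m m (\<lambda>ij. \<Sum>x<k. c x * B x $$ ij)"
  have "mat m m (\<lambda>ij. \<Sum>x<Suc k. c x * B x $$ ij) = ?S + c k \<cdot>\<^sub>m B k"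
    using Suc.prems[of k] by (intro eq_matI) auto
  then have "N (mat m m (\<lambda>ij. \<Sum>x<Suc k. c x * B x $$ ij)) = N ?S + c k \<cdot>\<^sub>m N (B k)"
    using Suc.prems[of k] linear_mapD[OF N] by simp
  also have "\<dots> = mat n n (\<lambda>ij. \<Sum>x<Suc k. c x * N (B x) $$ ij)"
    using Suc linear_mapD(1)[OF N Suc.prems[of k]] by (intro eq_matI) auto
  finally show ?case .
qed

text \<open>Inclusion of supports amounts to domination of \<open>X\<close> by a multiple of
  \<open>Y\<close>, which a positive linear map preserves.\<close>

lemma positive_map_supp:
  assumes N: "linear_map m n N" "\<And>X. psd m X \<Longrightarrow> psd n (N X)"
    and X: "psd m X" and Y: "psd m Y" and sub: "supp X \<subseteq> supp Y"
  shows "supp (N X) \<subseteq> supp (N Y)"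
proof -
  obtain c where "psd m (complex_of_real c \<cdot>\<^sub>m Y - X)"
    using supp_subset_dominated[OF X Y sub] .
  then have "psd n (N (complex_of_real c \<cdot>\<^sub>m Y - X))"
    by (rule N(2))
  also have "N (complex_of_real c \<cdot>\<^sub>m Y - X) = complex_of_real c \<cdot>\<^sub>m N Y - N X"
    using psd_carrier[OF X] psd_carrier[OF Y] by (simp add: linear_map_minus[OF N(1)] linear_mapD[OF N(1)])
  finally show ?thesis
    using N(2) X Y by (intro supp_subsetI)
qed

lemma on_snd_linear:
  assumes N: "linear_map m n N"
  shows "linear_map (r * m) (r * n) (on_snd r m n N)"
proof -
  have block_carrier: "block m X i j \<in> carrier_mat m m" for X i j
    by (simp add: block_def)
  have block_add: "block m (X + Y) i j = block m X i j + block m Y i j"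
    if "Y \<in> carrier_mat (r * m) (r * m)" "i < r" "j < r" for X Y i j
    using that by (intro eq_matI) (auto simp: block_def less_mult_add)
  have block_smult: "block m (c \<cdot>\<^sub>m X) i j = c \<cdot>\<^sub>m block m X i j"
    if "X \<in> carrier_mat (r * m) (r * m)" "i < r" "j < r" for c X i j
    using that by (intro eq_matI) (auto simp: block_def less_mult_add)
  have NB: "dim_row (N (block m X i j)) = n" "dim_col (N (block m X i j)) = n" for X i j
    using linear_mapD(1)[OF N block_carrier] by (auto dest: carrier_matD)
  show ?thesis
    unfolding linear_map_def
    by (auto intro!: eq_matI simp: on_snd_def div_mod_less block_add block_smult
        linear_mapD(2,3)[OF N block_carrier] linear_mapD(2)[OF N block_carrier block_carrier] NB)
qed

lemma marginal_fst_linear: "linear_map (a * b) a (marginal_fst a b)"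
  unfolding linear_map_def
  by (auto intro!: eq_matI simp: marginal_fst_def less_mult_add sum.distrib sum_distrib_left)

text \<open>Each entry of the first marginal is the trace of a block, and \<open>N\<close> preserves
  traces of blocks.\<close>

lemma marginal_fst_on_snd:
  assumes N: "channel m n N" and X: "X \<in> carrier_mat (r * m) (r * m)"
  shows "marginal_fst r n (on_snd r m n N X) = marginal_fst r m X"
proof (rule eq_matI)
  fix i j assume "i < dim_row (marginal_fst r m X)" "j < dim_col (marginal_fst r m X)"
  then have ij: "i < r" "j < r"
    by (simp_all add: marginal_fst_def)
  have B: "block m X i j \<in> carrier_mat m m"
    by (simp add: block_def)
  then have NB: "N (block m X i j) \<in> carrier_mat n n"
    using N by (auto simp: channel_def linear_map_def)
  have "marginal_fst r n (on_snd r m n N X) $$ (i, j) = mat_trace (N (block m X i j))"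
    using ij NB by (simp add: marginal_fst_def on_snd_def less_mult_add mat_trace_def)
  also have "\<dots> = mat_trace (block m X i j)"
    using N B by (simp add: channel_def trace_preserving_def)
  also have "\<dots> = marginal_fst r m X $$ (i, j)"
    using ij by (simp add: marginal_fst_def block_def mat_trace_def)
  finally show "marginal_fst r n (on_snd r m n N X) $$ (i, j) = marginal_fst r m X $$ (i, j)" .
qed (simp_all add: marginal_fst_def)

lemma state_marginal_fst: "state (a * b) \<rho> \<Longrightarrow> state a (marginal_fst a b \<rho>)"
  by (simp add: state_def marginal_fst_psd mat_trace_marginal_fst psd_carrier)

lemma channel_on_snd_psd: "channel m n N \<Longrightarrow> psd (r * m) X \<Longrightarrow> psd (r * n) (on_snd r m n N X)"
  by (simp add: channel_def completely_positive_def)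

lemma state_on_snd:
  assumes N: "channel m n N" and \<rho>: "state (r * m) \<rho>"
  shows "state (r * n) (on_snd r m n N \<rho>)"
proof -
  have \<rho>': "psd (r * m) \<rho>" "mat_trace \<rho> = 1"
    using \<rho> by (simp_all add: state_def)
  have psd: "psd (r * n) (on_snd r m n N \<rho>)"
    using N \<rho>'(1) by (rule channel_on_snd_psd)
  \<comment> \<open>The trace is computed on the first marginal, which \<open>N\<close> leaves
    unchanged.\<close>
  have "mat_trace (on_snd r m n N \<rho>) = mat_trace (marginal_fst r n (on_snd r m n N \<rho>))"
    using mat_trace_marginal_fst[OF psd_carrier[OF psd]] by simp
  also have "\<dots> = mat_trace \<rho>"
    using psd_carrier[OF \<rho>'(1)] by (simp add: marginal_fst_on_snd[OF N] mat_trace_marginal_fst)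
  finally show ?thesis
    using psd \<rho>'(2) by (simp add: state_def)
qed

section \<open>Traces, mixtures of states and the replacer channel\<close>

lemma mat_trace_add:
  "X \<in> carrier_mat n n \<Longrightarrow> Y \<in> carrier_mat n n \<Longrightarrow> mat_trace (X + Y) = mat_trace X + mat_trace Y"
  by (simp add: mat_trace_def sum.distrib)

lemma mat_trace_smult:
  "X \<in> carrier_mat n n \<Longrightarrow> mat_trace (c \<cdot>\<^sub>m X) = c * mat_trace X"
  by (simp add: mat_trace_def sum_distrib_left)

lemma mat_trace_minus:
  "X \<in> carrier_mat n n \<Longrightarrow> Y \<in> carrier_mat n n \<Longrightarrow> mat_trace (X - Y) = mat_trace X - mat_trace Y"
  by (simp add: mat_trace_def sum_subtractf)

lemma state_convex:
  assumes "state n \<rho>" "state n \<tau>" "0 \<le> t" "t \<le> 1"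
  shows "state n (complex_of_real t \<cdot>\<^sub>m \<rho> + complex_of_real (1 - t) \<cdot>\<^sub>m \<tau>)"
proof -
  have c: "\<rho> \<in> carrier_mat n n" "\<tau> \<in> carrier_mat n n"
    using assms by (simp_all add: state_def psd_carrier)
  then have "mat_trace (complex_of_real t \<cdot>\<^sub>m \<rho> + complex_of_real (1 - t) \<cdot>\<^sub>m \<tau>) = 1"
    using assms by (simp add: mat_trace_add[of _ n] mat_trace_smult[of _ n] state_def)
  then show ?thesis
    using assms psd_add[OF psd_smult psd_smult, of n \<rho> t \<tau> "1 - t"]
    by (simp add: state_def del: of_real_diff)
qed

text \<open>The channel that discards its input and prepares \<open>\<tau>\<close>. On a composite
  system it returns the remaining marginal tensored with \<open>\<tau>\<close>, hence complete
  positivity.\<close>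

lemma channel_replacer:
  assumes \<tau>: "state n \<tau>"
  shows "channel m n (\<lambda>X. mat_trace X \<cdot>\<^sub>m \<tau>)"
  unfolding channel_def
proof (intro conjI)
  have \<tau>': "psd n \<tau>" "\<tau> \<in> carrier_mat n n" "mat_trace \<tau> = 1"
    using \<tau> by (simp_all add: state_def psd_carrier)
  show "linear_map m n (\<lambda>X. mat_trace X \<cdot>\<^sub>m \<tau>)"
    using \<tau>' unfolding linear_map_def
    by (auto intro!: eq_matI simp: mat_trace_add[of _ m] mat_trace_smult[of _ m] distrib_right)
  show "trace_preserving m (\<lambda>X. mat_trace X \<cdot>\<^sub>m \<tau>)"
    using \<tau>' by (simp add: trace_preserving_def mat_trace_smult[of _ n])
  show "completely_positive m n (\<lambda>X. mat_trace X \<cdot>\<^sub>m \<tau>)"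
    unfolding completely_positive_def
  proof (intro allI impI)
    fix r X assume X: "psd (r * m) X"
    have "on_snd r m n (\<lambda>X. mat_trace X \<cdot>\<^sub>m \<tau>) X = kron (marginal_fst r m X) \<tau>"
      using \<tau>'(2) div_mod_less
      by (intro eq_matI)
        (auto simp: on_snd_def kron_def marginal_fst_def block_def mat_trace_def)
    then show "psd (r * n) (on_snd r m n (\<lambda>X. mat_trace X \<cdot>\<^sub>m \<tau>) X)"
      using kron_psd[OF marginal_fst_psd[OF X] \<tau>'(1)] by simp
  qed
qed

text \<open>
  The common value need not be \<open>0\<close>: adding a constant to \<open>D\<close> preserves all three properties.
\<close>

lemma divergence_self:
  assumes "quantum_divergence D" "state m \<rho>" "state n \<tau>"
  shows "D \<rho> \<rho> = D \<tau> \<tau>"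
proof -
  \<comment> \<open>The replacer channel sends both arguments to \<open>\<tau>\<close>, so this is
    data processing; exchanging the roles of the states gives equality.\<close>
  have "D \<tau> \<tau> \<le> D \<rho> \<rho>" if "state m \<rho>" "state n \<tau>" for m n \<rho> \<tau>
  proof -
    have "mat_trace \<rho> \<cdot>\<^sub>m \<tau> = \<tau>"
      using that by (intro eq_matI) (auto simp: state_def)
    then show ?thesis
      using assms(1) channel_replacer[OF that(2), of m] that(1)
      unfolding quantum_divergence_def by metis
  qed
  then show ?thesis
    using assms by (meson antisym)
qed

section \<open>Classical-quantum states\<close>

text \<open>The summand for \<open>x\<close> lives on the diagonal block \<open>x\<close>, so at
  most the summand for \<open>x = i div n\<close> survives.\<close>

lemma cq_mat_index:
  assumes "\<And>x. x < k \<Longrightarrow> \<rho>s x \<in> carrier_mat n n" and "i < k * n" "j < k * n"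
  shows "cq_mat k n p \<rho>s $$ (i, j) =
    (if i div n = j div n then complex_of_real (p (i div n)) * \<rho>s (i div n) $$ (i mod n, j mod n) else 0)"
proof -
  note dm = div_mod_less[OF assms(2)] div_mod_less[OF assms(3)]
  have "kron (basis_proj k x) (\<rho>s x) $$ (i, j) =
      (if i div n = x \<and> j div n = x then \<rho>s x $$ (i mod n, j mod n) else 0)" if "x < k" for x
    using dm assms(2,3) assms(1)[OF that] by (simp add: kron_def basis_proj_def)
  moreover have "cq_mat k n p \<rho>s $$ (i, j)
      = (\<Sum>x<k. complex_of_real (p x) * kron (basis_proj k x) (\<rho>s x) $$ (i, j))"
    using assms(2,3) by (simp add: cq_mat_def)
  ultimately have "cq_mat k n p \<rho>s $$ (i, j) =
      (\<Sum>x<k. if x = i div n then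
         (if i div n = j div n then complex_of_real (p (i div n)) * \<rho>s (i div n) $$ (i mod n, j mod n) else 0)
       else 0)"
    by (simp only:) (intro sum.cong refl, auto)
  then show ?thesis
    using dm by simp
qed

text \<open>Regrouping of three factors: an index of \<open>(U R) A\<close> is read as an index of
  \<open>U (R A)\<close>.\<close>

lemma mult_add_div_mod:
  fixes a :: nat
  assumes "a < m"
  shows "(i * m + a) div (r * m) = i div r" "(i * m + a) mod (r * m) = (i mod r) * m + a"
  using assms by (simp_all add: mult.commute[of r m] div_mult2_eq mod_mult2_eq mult.commute)

lemma marginal_fst_cq_mat:
  assumes \<rho>s: "\<And>x. x < k \<Longrightarrow> \<rho>s x \<in> carrier_mat (r * m) (r * m)"
  shows "marginal_fst (k * r) m (cq_mat k (r * m) p \<rho>s) = cq_mat k r p (\<lambda>x. marginal_fst r m (\<rho>s x))"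
proof (rule eq_matI)
  fix i j
  assume "i < dim_row (cq_mat k r p (\<lambda>x. marginal_fst r m (\<rho>s x)))"
    and "j < dim_col (cq_mat k r p (\<lambda>x. marginal_fst r m (\<rho>s x)))"
  then have ij: "i < k * r" "j < k * r"
    by (simp_all add: cq_mat_def)
  have "marginal_fst (k * r) m (cq_mat k (r * m) p \<rho>s) $$ (i, j) =
      (\<Sum>a<m. cq_mat k (r * m) p \<rho>s $$ (i * m + a, j * m + a))"
    using ij by (simp add: marginal_fst_def)
  also have "\<dots> = (\<Sum>a<m. if i div r = j div r then complex_of_real (p (i div r)) *
      \<rho>s (i div r) $$ ((i mod r) * m + a, (j mod r) * m + a) else 0)"
    using ij less_mult_add[of _ "k * r" _ m]
    by (intro sum.cong refl, subst cq_mat_index[OF \<rho>s])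
      (auto simp: mult_add_div_mod mult.assoc)
  also have "\<dots> = cq_mat k r p (\<lambda>x. marginal_fst r m (\<rho>s x)) $$ (i, j)"
    using ij div_mod_less[OF ij(1)] div_mod_less[OF ij(2)]
    by (subst cq_mat_index) (auto simp: marginal_fst_def sum_distrib_left)
  finally show "marginal_fst (k * r) m (cq_mat k (r * m) p \<rho>s) $$ (i, j) =
    cq_mat k r p (\<lambda>x. marginal_fst r m (\<rho>s x)) $$ (i, j)" .
qed (simp_all add: marginal_fst_def cq_mat_def)

lemma marginal_snd_cq_mat:
  assumes \<rho>s: "\<And>x. x < k \<Longrightarrow> \<rho>s x \<in> carrier_mat n n"
  shows "marginal_snd k n (cq_mat k n p \<rho>s) = mat n n (\<lambda>ij. \<Sum>x<k. complex_of_real (p x) * \<rho>s x $$ ij)"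
  by (intro eq_matI)
    (auto simp: marginal_snd_def cq_mat_index[OF \<rho>s] less_mult_add intro!: sum.cong)

lemma on_snd_cq_mat:
  assumes N: "linear_map m n N" and \<rho>s: "\<And>x. x < k \<Longrightarrow> \<rho>s x \<in> carrier_mat (r * m) (r * m)"
  shows "on_snd (k * r) m n N (cq_mat k (r * m) p \<rho>s) = cq_mat k (r * n) p (\<lambda>x. on_snd r m n N (\<rho>s x))"
proof (rule eq_matI)
  fix i j
  assume "i < dim_row (cq_mat k (r * n) p (\<lambda>x. on_snd r m n N (\<rho>s x)))"
    and "j < dim_col (cq_mat k (r * n) p (\<lambda>x. on_snd r m n N (\<rho>s x)))"
  then have ij: "i < k * r * n" "j < k * r * n"
    by (simp_all add: cq_mat_def mult.assoc)
  define I a J b where Ia: "I = i div n" "a = i mod n" "J = j div n" "b = j mod n"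
  have IJ: "I < k * r" "J < k * r" "a < n" "b < n"
    using div_mod_less[OF ij(1)] div_mod_less[OF ij(2)] by (simp_all add: Ia)
  have i: "i = I * n + a" "j = J * n + b"
    by (simp_all add: Ia)
  note dm = div_mod_less[OF IJ(1)] div_mod_less[OF IJ(2)]
  let ?B = "block m (\<rho>s (I div r)) (I mod r) (J mod r)"
  \<comment> \<open>The vanishing of blocks off the diagonal in \<open>U\<close> is put into the
    scalar, so that homogeneity of \<open>N\<close> covers both cases at once.\<close>
  have block: "block m (cq_mat k (r * m) p \<rho>s) I J =
      (if I div r = J div r then complex_of_real (p (I div r)) else 0) \<cdot>\<^sub>m ?B"
  proof (rule eq_matI)
    fix c d assume "c < dim_row ((if I div r = J div r then complex_of_real (p (I div r)) else 0) \<cdot>\<^sub>m ?B)"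
      "d < dim_col ((if I div r = J div r then complex_of_real (p (I div r)) else 0) \<cdot>\<^sub>m ?B)"
    then have cd: "c < m" "d < m"
      by (simp_all add: block_def)
    have "I * m + c < k * (r * m)" "J * m + d < k * (r * m)"
      using less_mult_add[OF IJ(1) cd(1)] less_mult_add[OF IJ(2) cd(2)] by (simp_all add: mult.assoc)
    then show "block m (cq_mat k (r * m) p \<rho>s) I J $$ (c, d) =
        ((if I div r = J div r then complex_of_real (p (I div r)) else 0) \<cdot>\<^sub>m ?B) $$ (c, d)"
      using cd by (simp add: block_def cq_mat_index[OF \<rho>s] mult_add_div_mod)
  qed (simp_all add: block_def)
  have B: "?B \<in> carrier_mat m m"
    by (simp add: block_def)
  have NB: "N ?B \<in> carrier_mat n n"
    using linear_mapD(1)[OF N B] .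
  have "on_snd (k * r) m n N (cq_mat k (r * m) p \<rho>s) $$ (i, j)
      = N (block m (cq_mat k (r * m) p \<rho>s) I J) $$ (a, b)"
    using ij by (simp add: on_snd_def Ia)
  also have "\<dots> = (if I div r = J div r then complex_of_real (p (I div r)) else 0) * N ?B $$ (a, b)"
    unfolding block linear_mapD(3)[OF N B] using NB IJ by simp
  also have "\<dots> = cq_mat k (r * n) p (\<lambda>x. on_snd r m n N (\<rho>s x)) $$ (i, j)"
  proof (subst cq_mat_index)
    show "(if I div r = J div r then complex_of_real (p (I div r)) else 0) * N ?B $$ (a, b) =
      (if i div (r * n) = j div (r * n) then complex_of_real (p (i div (r * n))) *
         on_snd r m n N (\<rho>s (i div (r * n))) $$ (i mod (r * n), j mod (r * n)) else 0)"
      unfolding i mult_add_div_mod[OF IJ(3)] mult_add_div_mod[OF IJ(4)]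
      using less_mult_add[OF dm(2) IJ(3)] less_mult_add[OF dm(4) IJ(4)] IJ
      by (simp add: on_snd_def)
  qed (use ij in \<open>simp_all add: on_snd_def mult.assoc\<close>)
  finally show "on_snd (k * r) m n N (cq_mat k (r * m) p \<rho>s) $$ (i, j)
      = cq_mat k (r * n) p (\<lambda>x. on_snd r m n N (\<rho>s x)) $$ (i, j)" .
qed (simp_all add: on_snd_def cq_mat_def mult.assoc)

section \<open>Conditional mutual information as an average of gaps\<close>

lemma mutual_info_cq_mat:
  assumes "direct_sum_property D" "ensemble k n p \<rho>s"
  shows "mutual_info D k n (cq_mat k n p \<rho>s) =
    (\<Sum>x<k. p x * D (\<rho>s x) (mat n n (\<lambda>ij. \<Sum>x<k. complex_of_real (p x) * \<rho>s x $$ ij)))"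
proof -
  have "marginal_snd k n (cq_mat k n p \<rho>s) = mat n n (\<lambda>ij. \<Sum>x<k. complex_of_real (p x) * \<rho>s x $$ ij)"
    using assms(2) by (intro marginal_snd_cq_mat) (simp add: ensemble_def state_def psd_carrier)
  moreover have "mutual_info D k n (cq_mat k n p \<rho>s)
      = (\<Sum>x<k. p x * D (\<rho>s x) (marginal_snd k n (cq_mat k n p \<rho>s)))"
    using assms unfolding direct_sum_property_def mutual_info_def Let_def by blast
  ultimately show ?thesis
    by simp
qed

text \<open>The channel output and its marginal without the last factor are both classical-quantum
  with weights \<open>p\<close>, so the direct-sum property applies to each. By linearity the
  averages of the components are the images of \<open>\<sigma>\<close>.\<close>

lemma cond_mutual_info_cq_mat:
  assumes D: "direct_sum_property D" and N: "channel m n N" and ens: "ensemble k (r * m) p \<rho>s"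
    and \<sigma>: "\<sigma> = mat (r * m) (r * m) (\<lambda>ij. \<Sum>x<k. complex_of_real (p x) * \<rho>s x $$ ij)"
  shows "cond_mutual_info D k r n (on_snd (k * r) m n N (cq_mat k (r * m) p \<rho>s)) =
    (\<Sum>x<k. p x * (D (on_snd r m n N (\<rho>s x)) (on_snd r m n N \<sigma>)
       - D (marginal_fst r m (\<rho>s x)) (marginal_fst r m \<sigma>)))"
proof -
  have st: "\<And>x. x < k \<Longrightarrow> state (r * m) (\<rho>s x)"
    using ens by (simp add: ensemble_def)
  then have \<rho>s: "\<And>x. x < k \<Longrightarrow> \<rho>s x \<in> carrier_mat (r * m) (r * m)"
    by (simp add: state_def psd_carrier)
  have lin: "linear_map m n N"
    using N by (simp add: channel_def)
  have lin_snd: "linear_map (r * m) (r * n) (on_snd r m n N)"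
    using on_snd_linear[OF lin] .
  have \<rho>s': "\<And>x. x < k \<Longrightarrow> on_snd r m n N (\<rho>s x) \<in> carrier_mat (r * n) (r * n)"
    by (simp add: on_snd_def)
  have ensN: "ensemble k (r * n) p (\<lambda>x. on_snd r m n N (\<rho>s x))"
    using ens state_on_snd[OF N] by (simp add: ensemble_def)
  have ensR: "ensemble k r p (\<lambda>x. marginal_fst r m (\<rho>s x))"
    using ens state_marginal_fst by (simp add: ensemble_def)
  have marg: "marginal_fst (k * r) n (cq_mat k (r * n) p (\<lambda>x. on_snd r m n N (\<rho>s x)))
      = cq_mat k r p (\<lambda>x. marginal_fst r m (\<rho>s x))"
    by (subst marginal_fst_cq_mat[OF \<rho>s'], assumption) (simp add: cq_mat_def marginal_fst_on_snd[OF N \<rho>s])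
  show ?thesis
    by (simp add: cond_mutual_info_def \<sigma> on_snd_cq_mat[OF lin \<rho>s] marg
        mutual_info_cq_mat[OF D ensN] mutual_info_cq_mat[OF D ensR]
        linear_map_sum[OF lin_snd \<rho>s] linear_map_sum[OF marginal_fst_linear \<rho>s]
        sum_subtractf right_diff_distrib)
qed

text \<open>The comparison \<open>le\<close> concerns positive weights only: a component of weight
  \<open>0\<close> may have support outside that of \<open>\<sigma>\<close>.\<close>

lemma cond_mutual_info_le:
  assumes D: "direct_sum_property D" and N: "channel m n N" and M: "channel m n' M"
    and ens: "ensemble k (r * m) p \<rho>s"
    and \<sigma>: "marginal_snd k (r * m) (cq_mat k (r * m) p \<rho>s) = \<sigma>"
    and le: "\<And>x. x < k \<Longrightarrow> 0 < p x \<Longrightarrow>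
      D (on_snd r m n N (\<rho>s x)) (on_snd r m n N \<sigma>) - D (marginal_fst r m (\<rho>s x)) (marginal_fst r m \<sigma>)
      \<le> \<eta> * (D (on_snd r m n' M (\<rho>s x)) (on_snd r m n' M \<sigma>)
          - D (marginal_fst r m (\<rho>s x)) (marginal_fst r m \<sigma>))"
  shows "cond_mutual_info D k r n (on_snd (k * r) m n N (cq_mat k (r * m) p \<rho>s))
    \<le> \<eta> * cond_mutual_info D k r n' (on_snd (k * r) m n' M (cq_mat k (r * m) p \<rho>s))"
proof -
  have "\<And>x. x < k \<Longrightarrow> \<rho>s x \<in> carrier_mat (r * m) (r * m)"
    using ens by (simp add: ensemble_def state_def psd_carrier)
  then have \<sigma>': "\<sigma> = mat (r * m) (r * m) (\<lambda>ij. \<Sum>x<k. complex_of_real (p x) * \<rho>s x $$ ij)"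
    using \<sigma> marginal_snd_cq_mat by blast
  show ?thesis
    unfolding cond_mutual_info_cq_mat[OF D N ens \<sigma>'] cond_mutual_info_cq_mat[OF D M ens \<sigma>']
      sum_distrib_left[of \<eta>]
  proof (rule sum_mono)
    fix x assume "x \<in> {..<k}"
    then have x: "x < k" "0 \<le> p x"
      using ens by (auto simp: ensemble_def)
    let ?G = "\<lambda>n N. D (on_snd r m n N (\<rho>s x)) (on_snd r m n N \<sigma>)
      - D (marginal_fst r m (\<rho>s x)) (marginal_fst r m \<sigma>)"
    have "p x * ?G n N \<le> p x * (\<eta> * ?G n' M)"
      using x le[of x] by (cases "p x = 0") (auto intro: mult_left_mono)
    then show "p x * ?G n N \<le> \<eta> * (p x * ?G n' M)"
      by (simp add: mult.left_commute)
  qed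
qed

text \<open>The other summands of the mixture are positive, so \<open>\<sigma>\<close> dominates
  \<open>p x\<close> times the component.\<close>

lemma supp_component:
  assumes ens: "ensemble k n p \<rho>s" and \<sigma>: "marginal_snd k n (cq_mat k n p \<rho>s) = \<sigma>"
    and x: "x < k" "0 < p x" and psd_\<sigma>: "psd n \<sigma>"
  shows "supp (\<rho>s x) \<subseteq> supp \<sigma>"
proof (rule supp_subsetI)
  have psd: "psd n (\<rho>s y)" if "y < k" for y
    using ens that by (simp add: ensemble_def state_def)
  show "psd n (\<rho>s x)"
    using psd x by simp
  show "psd n \<sigma>"
    by fact
  have carrier: "\<rho>s y \<in> carrier_mat n n" if "y < k" for y
    using psd[OF that] psd_carrier by blast
  have \<sigma>': "\<sigma> = mat n n (\<lambda>ij. \<Sum>y<k. complex_of_real (p y) * \<rho>s y $$ ij)"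
    using \<sigma> carrier marginal_snd_cq_mat by blast
  let ?F = "\<lambda>y i j. \<rho>s y $$ (i, j)"
  have "qform n (\<lambda>i j. \<sigma> $$ (i, j)) v = (\<Sum>y<k. complex_of_real (p y) * qform n (?F y) v)" for v
  proof -
    have "qform n (\<lambda>i j. \<sigma> $$ (i, j)) v
        = (\<Sum>i<n. \<Sum>j<n. \<Sum>y<k. complex_of_real (p y) * (?F y i j * v j * cnj (v i)))"
      by (simp add: \<sigma>' qform_def sum_distrib_right mult.assoc)
    also have "\<dots> = (\<Sum>i<n. \<Sum>y<k. \<Sum>j<n. complex_of_real (p y) * (?F y i j * v j * cnj (v i)))"
      by (intro sum.cong refl sum.swap)
    also have "\<dots> = (\<Sum>y<k. \<Sum>i<n. \<Sum>j<n. complex_of_real (p y) * (?F y i j * v j * cnj (v i)))"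
      by (rule sum.swap)
    finally show ?thesis
      by (simp add: qform_def sum_distrib_left)
  qed
  moreover have "complex_of_real (p x) * qform n (?F x) v
      \<le> (\<Sum>y<k. complex_of_real (p y) * qform n (?F y) v)" for v
    using x ens psd by (intro member_le_sum)
      (auto simp: psd_iff_qform ensemble_def less_eq_complex_def)
  ultimately have le: "complex_of_real (p x) * qform n (?F x) v \<le> qform n (\<lambda>i j. \<sigma> $$ (i, j)) v" for v
    by simp
  have "0 \<le> qform n (\<lambda>i j. (complex_of_real (1 / p x) \<cdot>\<^sub>m \<sigma> - \<rho>s x) $$ (i, j)) v" for v
    using le[of v] carrier[OF x(1)] psd_carrier[OF psd_\<sigma>] x(2)
    by (simp add: qform_minus qform_smult less_eq_complex_def field_simps)
  then show "psd n (complex_of_real (1 / p x) \<cdot>\<^sub>m \<sigma> - \<rho>s x)"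
    using carrier[OF x(1)] by (simp add: psd_iff_qform minus_carrier_mat)
qed

text \<open>Exhibits \<open>\<sigma>\<close> as a mixture of \<open>\<rho>\<close> and a state
  \<open>\<tau>\<close>, both with positive weight.\<close>

lemma supp_subset_split:
  assumes \<rho>: "state n \<rho>" and \<sigma>: "state n \<sigma>" and sub: "supp \<rho> \<subseteq> supp \<sigma>"
  obtains a \<tau> where "0 < a" "state n \<tau>" "supp \<tau> \<subseteq> supp \<sigma>"
    "complex_of_real (1 + a) \<cdot>\<^sub>m \<sigma> = \<rho> + complex_of_real a \<cdot>\<^sub>m \<tau>"
proof -
  have psd: "psd n \<rho>" "psd n \<sigma>" and tr: "mat_trace \<rho> = 1" "mat_trace \<sigma> = 1"
    using \<rho> \<sigma> by (simp_all add: state_def)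
  note c = psd_carrier[OF psd(1)] psd_carrier[OF psd(2)]
  obtain a where a: "0 < a" and dom: "psd n (complex_of_real a \<cdot>\<^sub>m \<sigma> - \<rho>)"
    using supp_subset_dominated[OF psd sub] .
  \<comment> \<open>The additional \<open>\<sigma>\<close> raises the trace from
    \<open>a - 1\<close>, which could be \<open>0\<close>, to \<open>a\<close>; normalisation is
    then always possible.\<close>
  define \<tau> where "\<tau> = complex_of_real (1 / a) \<cdot>\<^sub>m (\<sigma> + (complex_of_real a \<cdot>\<^sub>m \<sigma> - \<rho>))"
  have c': "\<sigma> + (complex_of_real a \<cdot>\<^sub>m \<sigma> - \<rho>) \<in> carrier_mat n n"
    using c by (simp add: minus_carrier_mat)
  have psd_\<tau>: "psd n \<tau>"
    unfolding \<tau>_def using a by (intro psd_smult psd_add psd dom) simp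
  have "mat_trace \<tau> = 1"
    using a c c' tr
    by (simp add: \<tau>_def mat_trace_smult[of _ n] mat_trace_add[of _ n] mat_trace_minus[of _ n]
        minus_carrier_mat)
  then have "state n \<tau>"
    using psd_\<tau> by (simp add: state_def)
  moreover have eq: "complex_of_real (1 + a) \<cdot>\<^sub>m \<sigma> = \<rho> + complex_of_real a \<cdot>\<^sub>m \<tau>"
    using a c by (intro eq_matI) (auto simp: \<tau>_def field_simps)
  moreover have "supp \<tau> \<subseteq> supp \<sigma>"
  proof (rule supp_subsetI[OF psd_\<tau> psd(2)])
    have "complex_of_real ((1 + a) / a) \<cdot>\<^sub>m \<sigma> - \<tau> = complex_of_real (1 / a) \<cdot>\<^sub>m \<rho>"
      using a c by (intro eq_matI) (auto simp: \<tau>_def field_simps)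
    then show "psd n (complex_of_real ((1 + a) / a) \<cdot>\<^sub>m \<sigma> - \<tau>)"
      using psd_smult[OF psd(1), of "1 / a"] a by simp
  qed
  ultimately show ?thesis
    using that a by blast
qed

section \<open>The first-order behaviour of the gap at \<open>\<sigma>\<close>\<close>

lemma linear_map_convex:
  assumes "linear_map m n N" "X \<in> carrier_mat m m" "Y \<in> carrier_mat m m"
  shows "N (a \<cdot>\<^sub>m X + b \<cdot>\<^sub>m Y) = a \<cdot>\<^sub>m N X + b \<cdot>\<^sub>m N Y"
  using assms by (simp add: linear_mapD[OF assms(1)])

lemma divergence_gap_quotient_tendsto_0:
  assumes D: "quantum_divergence D" "vanishing_first_derivative D" and N: "channel m n N"
    and \<tau>: "state (r * m) \<tau>" and \<sigma>: "state (r * m) \<sigma>" and sub: "supp \<tau> \<subseteq> supp \<sigma>"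
  defines "\<sigma>t \<equiv> \<lambda>t. complex_of_real t \<cdot>\<^sub>m \<tau> + complex_of_real (1 - t) \<cdot>\<^sub>m \<sigma>"
  shows "((\<lambda>t. (D (on_snd r m n N (\<sigma>t t)) (on_snd r m n N \<sigma>)
      - D (marginal_fst r m (\<sigma>t t)) (marginal_fst r m \<sigma>)) / t) \<longlongrightarrow> 0) (at_right 0)"
proof -
  \<comment> \<open>Stated for a general positive linear map \<open>L\<close>, to be used for both
    the channel on the second factor and the marginal on the first.\<close>
  have quotient: "((\<lambda>t. (D (complex_of_real t \<cdot>\<^sub>m L \<tau> + complex_of_real (1 - t) \<cdot>\<^sub>m L \<sigma>) (L \<sigma>)
      - D (L \<sigma>) (L \<sigma>)) / t) \<longlongrightarrow> 0) (at_right 0)"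
    if L: "linear_map (r * m) k L" "\<And>X. psd (r * m) X \<Longrightarrow> psd k (L X)" "state k (L \<tau>)" "state k (L \<sigma>)"
    for k L
  proof -
    have "supp (L \<tau>) \<subseteq> supp (L \<sigma>)"
      using positive_map_supp[OF L(1,2) _ _ sub] \<tau> \<sigma> by (simp add: state_def)
    then have "((\<lambda>t. D (complex_of_real t \<cdot>\<^sub>m L \<tau> + complex_of_real (1 - t) \<cdot>\<^sub>m L \<sigma>) (L \<sigma>))
        has_real_derivative 0) (at_right 0)"
      using D(2) L(3,4) unfolding vanishing_first_derivative_def by blast
    \<comment> \<open>The mixture at \<open>t = 0\<close> identifies the base value of the
      difference quotient as \<open>D (L \<sigma>) (L \<sigma>)\<close>.\<close>
    moreover have "complex_of_real 0 \<cdot>\<^sub>m L \<tau> + complex_of_real (1 - 0) \<cdot>\<^sub>m L \<sigma> = L \<sigma>"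
      using L(3,4) by (intro eq_matI) (auto simp: state_def dest!: psd_carrier)
    ultimately show ?thesis
      by (simp add: has_field_derivative_iff)
  qed
  have c: "\<tau> \<in> carrier_mat (r * m) (r * m)" "\<sigma> \<in> carrier_mat (r * m) (r * m)"
    using \<tau> \<sigma> by (simp_all add: state_def psd_carrier)
  have lin: "linear_map (r * m) (r * n) (on_snd r m n N)"
    using N on_snd_linear by (simp add: channel_def)
  \<comment> \<open>The base values of the two quotients agree although the dimensions differ, so
    they cancel when the limits are subtracted.\<close>
  have self: "D (on_snd r m n N \<sigma>) (on_snd r m n N \<sigma>) = D (marginal_fst r m \<sigma>) (marginal_fst r m \<sigma>)"
    using divergence_self[OF D(1) state_on_snd[OF N \<sigma>] state_marginal_fst[OF \<sigma>]] .
  have 1: "((\<lambda>t. (D (on_snd r m n N (\<sigma>t t)) (on_snd r m n N \<sigma>)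
      - D (on_snd r m n N \<sigma>) (on_snd r m n N \<sigma>)) / t) \<longlongrightarrow> 0) (at_right 0)"
    unfolding \<sigma>t_def linear_map_convex[OF lin c]
    by (rule quotient[OF lin channel_on_snd_psd[OF N] state_on_snd[OF N \<tau>] state_on_snd[OF N \<sigma>]])
  have 2: "((\<lambda>t. (D (marginal_fst r m (\<sigma>t t)) (marginal_fst r m \<sigma>)
      - D (marginal_fst r m \<sigma>) (marginal_fst r m \<sigma>)) / t) \<longlongrightarrow> 0) (at_right 0)"
    unfolding \<sigma>t_def linear_map_convex[OF marginal_fst_linear c]
    by (rule quotient[OF marginal_fst_linear marginal_fst_psd state_marginal_fst[OF \<tau>]
        state_marginal_fst[OF \<sigma>]])
  show ?thesis
    using tendsto_diff[OF 1 2] by (simp add: self diff_divide_distrib)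
qed

theorem mainTheorem6:
  fixes D :: divergence
    and N M :: "complex mat \<Rightarrow> complex mat"
    and dR dA dB dB' :: nat
    and \<sigma> :: "complex mat"
    and \<eta> :: real
  assumes "quantum_divergence D"
    and "direct_sum_property D"
    and "vanishing_first_derivative D"
    and "channel dA dB' N"
    and "channel dA dB M"
    and "state (dR * dA) \<sigma>"
    and "\<eta> \<ge> 0"
  defines "i \<equiv>
      \<forall>\<rho>. cq_state 2 (dR * dA) \<rho> \<longrightarrow> marginal_snd 2 (dR * dA) \<rho> = \<sigma> \<longrightarrow>
        \<eta> * cond_mutual_info D 2 dR dB (on_snd (2 * dR) dA dB M \<rho>)
          \<ge> cond_mutual_info D 2 dR dB' (on_snd (2 * dR) dA dB' N \<rho>)"
    and "ii \<equiv>
      \<forall>k \<rho>. cq_state k (dR * dA) \<rho> \<longrightarrow> marginal_snd k (dR * dA) \<rho> = \<sigma> \<longrightarrow>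
        \<eta> * cond_mutual_info D k dR dB (on_snd (k * dR) dA dB M \<rho>)
          \<ge> cond_mutual_info D k dR dB' (on_snd (k * dR) dA dB' N \<rho>)"
    and "iii \<equiv>
      \<forall>\<rho>. state (dR * dA) \<rho> \<longrightarrow> supp \<rho> \<subseteq> supp \<sigma> \<longrightarrow>
        \<eta> * (D (on_snd dR dA dB M \<rho>) (on_snd dR dA dB M \<sigma>)
             - D (marginal_fst dR dA \<rho>) (marginal_fst dR dA \<sigma>))
          \<ge> D (on_snd dR dA dB' N \<rho>) (on_snd dR dA dB' N \<sigma>)
             - D (marginal_fst dR dA \<rho>) (marginal_fst dR dA \<sigma>)"
  shows "(i \<longleftrightarrow> ii) \<and> (ii \<longleftrightarrow> iii)"
proof -
  have "ii \<Longrightarrow> i"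
    unfolding i_def ii_def by blast
  moreover have "iii \<Longrightarrow> ii"
    unfolding ii_def
  proof (intro allI impI)
    fix k \<rho>
    assume iii: iii and cq: "cq_state k (dR * dA) \<rho>" and marg: "marginal_snd k (dR * dA) \<rho> = \<sigma>"
    obtain p \<rho>s where ens: "ensemble k (dR * dA) p \<rho>s" and \<rho>: "\<rho> = cq_mat k (dR * dA) p \<rho>s"
      using cq unfolding cq_state_def by blast
    have "state (dR * dA) (\<rho>s x)" "supp (\<rho>s x) \<subseteq> supp \<sigma>" if "x < k" "0 < p x" for x
      using ens that assms(6) supp_component[OF ens marg[unfolded \<rho>] that]
      by (auto simp: ensemble_def state_def)
    then show "cond_mutual_info D k dR dB' (on_snd (k * dR) dA dB' N \<rho>)
        \<le> \<eta> * cond_mutual_info D k dR dB (on_snd (k * dR) dA dB M \<rho>)"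
      unfolding \<rho> using iii
      by (intro cond_mutual_info_le[OF assms(2,4,5) ens marg[unfolded \<rho>]]) (simp add: iii_def)
  qed
  moreover have "i \<Longrightarrow> iii"
    unfolding iii_def
  proof (intro allI impI)
    fix \<rho>
    assume i: i and \<rho>: "state (dR * dA) \<rho>" and sub: "supp \<rho> \<subseteq> supp \<sigma>"
    obtain a \<tau> where a: "0 < a" and \<tau>: "state (dR * dA) \<tau>" "supp \<tau> \<subseteq> supp \<sigma>"
      and split: "complex_of_real (1 + a) \<cdot>\<^sub>m \<sigma> = \<rho> + complex_of_real a \<cdot>\<^sub>m \<tau>"
      using supp_subset_split[OF \<rho> assms(6) sub] .
    have c: "\<rho> \<in> carrier_mat (dR * dA) (dR * dA)" "\<sigma> \<in> carrier_mat (dR * dA) (dR * dA)"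
      "\<tau> \<in> carrier_mat (dR * dA) (dR * dA)"
      using \<rho> \<tau> assms(6) by (simp_all add: state_def psd_carrier)
    define \<sigma>t where "\<sigma>t t = complex_of_real t \<cdot>\<^sub>m \<tau> + complex_of_real (1 - t) \<cdot>\<^sub>m \<sigma>" for t
    define G where "G n L X = D (on_snd dR dA n L X) (on_snd dR dA n L \<sigma>)
      - D (marginal_fst dR dA X) (marginal_fst dR dA \<sigma>)" for n L X
    \<comment> \<open>Condition (i) for the ensemble with weight \<open>t / (a + t)\<close> on \<open>\<rho>\<close> and the remaining weight on
      \<open>\<sigma>t t\<close>, divided by \<open>t / (a + t)\<close>.\<close>
    have gap: "G dB' N \<rho> + a * (G dB' N (\<sigma>t t) / t) \<le> \<eta> * (G dB M \<rho> + a * (G dB M (\<sigma>t t) / t))"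
      if t: "0 < t" "t < 1" for t
    proof -
      define p where "p x = (if x = 0 then t / (a + t) else a / (a + t))" for x :: nat
      define \<rho>s where "\<rho>s x = (if x = 0 then \<rho> else \<sigma>t t)" for x :: nat
      have ens: "ensemble 2 (dR * dA) p \<rho>s"
        using a t \<rho> state_convex[OF \<tau>(1) assms(6), of t]
        by (auto simp: ensemble_def p_def \<rho>s_def \<sigma>t_def numeral_2_eq_2 add_divide_distrib[symmetric])
      \<comment> \<open>Multiplying \<open>split\<close> by \<open>t\<close> and adding
        \<open>a (1 - t) \<sigma>\<close> on both sides gives
        \<open>(a + t) \<sigma> = t \<rho> + a \<sigma>t\<close>, which explains the weights
        \<open>p\<close>.\<close>
      have mix: "\<sigma> = mat (dR * dA) (dR * dA) (\<lambda>ij. \<Sum>x<2. complex_of_real (p x) * \<rho>s x $$ ij)"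
      proof (rule eq_matI)
        fix j l assume "j < dim_row (mat (dR * dA) (dR * dA) (\<lambda>ij. \<Sum>x<2. complex_of_real (p x) * \<rho>s x $$ ij))"
          "l < dim_col (mat (dR * dA) (dR * dA) (\<lambda>ij. \<Sum>x<2. complex_of_real (p x) * \<rho>s x $$ ij))"
        then have jl: "j < dR * dA" "l < dR * dA"
          by simp_all
        have eq: "(1 + complex_of_real a) * \<sigma> $$ (j, l) = \<rho> $$ (j, l) + complex_of_real a * \<tau> $$ (j, l)"
          using arg_cong[OF split, of "\<lambda>X. X $$ (j, l)"] jl c by simp
        have at: "complex_of_real a + complex_of_real t \<noteq> 0"
          using a t by (simp flip: of_real_add)
        have "complex_of_real t * \<rho> $$ (j, l) + complex_of_real a *
            (complex_of_real t * \<tau> $$ (j, l) + (1 - complex_of_real t) * \<sigma> $$ (j, l))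
            = (complex_of_real a + complex_of_real t) * \<sigma> $$ (j, l)"
          using arg_cong[OF eq, of "\<lambda>z. complex_of_real t * z"] by (simp add: algebra_simps)
        then show "\<sigma> $$ (j, l) = mat (dR * dA) (dR * dA) (\<lambda>ij. \<Sum>x<2. complex_of_real (p x) * \<rho>s x $$ ij) $$ (j, l)"
          using jl c at
          by (simp add: numeral_2_eq_2 p_def \<rho>s_def \<sigma>t_def flip: add_divide_distrib)
      qed (use c in simp_all)
      have "\<And>x. x < 2 \<Longrightarrow> \<rho>s x \<in> carrier_mat (dR * dA) (dR * dA)"
        using ens by (simp add: ensemble_def state_def psd_carrier)
      then have marg: "marginal_snd 2 (dR * dA) (cq_mat 2 (dR * dA) p \<rho>s) = \<sigma>"
        using mix marginal_snd_cq_mat by metis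
      have info: "cond_mutual_info D 2 dR n (on_snd (2 * dR) dA n L (cq_mat 2 (dR * dA) p \<rho>s))
          = (t / (a + t)) * (G n L \<rho> + a * (G n L (\<sigma>t t) / t))" if "channel dA n L" for n L
      proof -
        have "cond_mutual_info D 2 dR n (on_snd (2 * dR) dA n L (cq_mat 2 (dR * dA) p \<rho>s))
            = (\<Sum>x<2. p x * G n L (\<rho>s x))"
          unfolding G_def by (rule cond_mutual_info_cq_mat[OF assms(2) that ens mix])
        also have "\<dots> = (t / (a + t)) * G n L \<rho> + (a / (a + t)) * G n L (\<sigma>t t)"
          by (simp add: numeral_2_eq_2 p_def \<rho>s_def)
        also have "\<dots> = (t / (a + t)) * (G n L \<rho> + a * (G n L (\<sigma>t t) / t))"
          using t by (simp add: distrib_left)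
        finally show ?thesis .
      qed
      have "cq_state 2 (dR * dA) (cq_mat 2 (dR * dA) p \<rho>s)"
        using ens unfolding cq_state_def by blast
      then have "(t / (a + t)) * (G dB' N \<rho> + a * (G dB' N (\<sigma>t t) / t))
          \<le> \<eta> * ((t / (a + t)) * (G dB M \<rho> + a * (G dB M (\<sigma>t t) / t)))"
        using i marg unfolding i_def info[OF assms(4), symmetric] info[OF assms(5), symmetric] by blast
      then have "(t / (a + t)) * (G dB' N \<rho> + a * (G dB' N (\<sigma>t t) / t))
          \<le> (t / (a + t)) * (\<eta> * (G dB M \<rho> + a * (G dB M (\<sigma>t t) / t)))"
        by (simp only: mult.left_commute)
      moreover have "0 < t / (a + t)"
        using a t by simp
      ultimately show ?thesis
        by (rule mult_left_le_imp_le)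
    qed
    have lim: "((\<lambda>t. G n L \<rho> + a * (G n L (\<sigma>t t) / t)) \<longlongrightarrow> G n L \<rho> + a * 0) (at_right 0)"
      if "channel dA n L" for n L
      using divergence_gap_quotient_tendsto_0[OF assms(1,3) that \<tau>(1) assms(6) \<tau>(2)]
      unfolding G_def \<sigma>t_def by (intro tendsto_intros)
    have "eventually (\<lambda>t. 0 < t \<and> t < (1::real)) (at_right 0)"
      using eventually_at_right_real[of 0 1] by simp
    then have "eventually (\<lambda>t. G dB' N \<rho> + a * (G dB' N (\<sigma>t t) / t)
        \<le> \<eta> * (G dB M \<rho> + a * (G dB M (\<sigma>t t) / t))) (at_right 0)"
      by eventually_elim (use gap in blast)
    \<comment> \<open>The inequality \<open>gap\<close> is not strict, so it passes to the limit
      from the right at \<open>0\<close>.\<close>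
    then have "G dB' N \<rho> + a * 0 \<le> \<eta> * (G dB M \<rho> + a * 0)"
      using lim[OF assms(4)] tendsto_mult_left[OF lim[OF assms(5)], of \<eta>]
      by (intro tendsto_le[OF trivial_limit_at_right_real]) auto
    then show "D (on_snd dR dA dB' N \<rho>) (on_snd dR dA dB' N \<sigma>)
          - D (marginal_fst dR dA \<rho>) (marginal_fst dR dA \<sigma>)
        \<le> \<eta> * (D (on_snd dR dA dB M \<rho>) (on_snd dR dA dB M \<sigma>)
          - D (marginal_fst dR dA \<rho>) (marginal_fst dR dA \<sigma>))"
      by (simp add: G_def)
  qed
  ultimately show ?thesis
    by blast
qed

end
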